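(* Let $k\geq 2$, $n\geq 1$ and $r\geq 1$ be integers with $r\leq\frac{(k-1)(2n)}{k}$, and let $\mathcal{F}\subseteq\mathcal{H}^r(M_n)$ be $k$-wise intersecting. Then $$|\mathcal{F}|\leq\begin{cases}2^{r-1}\binom{n-1}{r-1} & \text{if } r\leq n,\\ 2^{2n-r}\binom{n-1}{r-n-1}+2^{2n-r-1}\binom{n-1}{r-n} & \text{otherwise.}\end{cases}$$ If $r<\frac{(k-1)(2n)}{k}$, then equality holds if and only if $\mathcal{F}=\mathcal{H}^r_x(M_n)$ for some vertex $x$ of $M_n$.
   Context: $M_n$ is the perfect matching graph on $2n$ vertices: vertex set $\{1,\dots,2n\}$ and edges $\{i,n+i\}$ for $i=1,\dots,n$. For a graph $G$ and $r\geq1$, $\mathcal{I}^r(G)$ is the family of independent vertex sets of size $r$, $\mathcal{M}^r(G)$ is the family of vertex sets of size $r$ containing a maximum independent set, and $\mathcal{H}^r(G)=\mathcal{I}^r(G)\cup\mathcal{M}^r(G)$. For a vertex $x$, $\mathcal{H}^r_x(G)=\{A\in\mathcal{H}^r(G): x\in A\}$. A family $\mathcal{F}$ is $k$-wise intersecting if $F_1\cap\cdots\cap F_k\neq\emptyset$ for all $F_1,\dots,F_k\in\mathcal{F}$. *)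

theory Defs
  imports Main
begin

(* A finite simple graph is given by a vertex set V and a set E of edges,
   each edge being a 2-element subset of V. *)

definition Mn_V :: "nat \<Rightarrow> nat set" where
  "Mn_V n = {1..2*n}"

definition Mn_E :: "nat \<Rightarrow> nat set set" where
  "Mn_E n = {{i, n + i} | i. i \<in> {1..n}}"

definition independent :: "'a set \<Rightarrow> 'a set set \<Rightarrow> 'a set \<Rightarrow> bool" where
  "independent V E S \<longleftrightarrow> S \<subseteq> V \<and> (\<forall>e\<in>E. \<not> e \<subseteq> S)"

definition maximum_independent :: "'a set \<Rightarrow> 'a set set \<Rightarrow> 'a set \<Rightarrow> bool" where
  "maximum_independent V E S \<longleftrightarrow> independent V E S \<and>
     (\<forall>T. independent V E T \<longrightarrow> card T \<le> card S)"

definition I_fam :: "nat \<Rightarrow> 'a set \<Rightarrow> 'a set set \<Rightarrow> 'a set set" where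
  "I_fam r V E = {A. independent V E A \<and> card A = r}"

definition M_fam :: "nat \<Rightarrow> 'a set \<Rightarrow> 'a set set \<Rightarrow> 'a set set" where
  "M_fam r V E = {A. A \<subseteq> V \<and> card A = r \<and> (\<exists>S. maximum_independent V E S \<and> S \<subseteq> A)}"

definition H_fam :: "nat \<Rightarrow> 'a set \<Rightarrow> 'a set set \<Rightarrow> 'a set set" where
  "H_fam r V E = I_fam r V E \<union> M_fam r V E"

definition H_star :: "nat \<Rightarrow> 'a set \<Rightarrow> 'a set set \<Rightarrow> 'a \<Rightarrow> 'a set set" where
  "H_star r V E x = {A \<in> H_fam r V E. x \<in> A}"

definition k_wise_intersecting :: "nat \<Rightarrow> 'a set set \<Rightarrow> bool" where
  "k_wise_intersecting k F \<longleftrightarrow>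
     (\<forall>f :: nat \<Rightarrow> 'a set. (\<forall>i<k. f i \<in> F) \<longrightarrow> (\<Inter>i<k. f i) \<noteq> {})"

definition bound :: "nat \<Rightarrow> nat \<Rightarrow> nat" where
  "bound n r = (if r \<le> n then 2^(r-1) * ((n-1) choose (r-1))
     else 2^(2*n-r) * ((n-1) choose (r-n-1)) + 2^(2*n-r-1) * ((n-1) choose (r-n)))"

end

theory Submission
  imports Defs "HOL-Combinatorics.Permutations"
begin

text \<open>
  Katona's cycle method. Place the \<open>2n\<close> vertices on a cycle so that the two ends of every edge are
  antipodal. All \<open>2n\<close> arcs of length \<open>r\<close> are then members of \<open>H\<^sup>r\<close>, and the automorphisms of the
  graph permute such placements and act transitively on \<open>H\<^sup>r\<close>. Passing to complements, a \<open>k\<close>-wise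
  intersecting family contributes a set of arcs of length \<open>s = 2n - r\<close>, no \<open>k\<close> of which cover the
  cycle; since \<open>2n \<le> ks\<close>, there are at most \<open>r\<close> of them. A star contributes exactly \<open>r\<close> arcs in every
  placement, so averaging over all automorphisms bounds the family by the size of a star.

  If \<open>2n < ks\<close> and the bound is attained, every placement contributes exactly \<open>r\<close> arcs, and these are
  all the arcs through one position, the centre. Swapping two adjacent positions that are neither
  the centre nor antipodal to it keeps the centre, because a vertex set containing an arc of
  length \<open>s - 1\<close> around the centre cannot be the complement of a member. With such swaps every
  independent set through the central vertex \<open>v\<close> becomes an arc. For \<open>r \<le> n\<close> the star of \<open>v\<close> is
  therefore contained in the family; for \<open>r > n\<close>, applied to the complement of a member avoiding
  \<open>v\<close>, this shows that every member contains \<open>v\<close>.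
\<close>

subsection \<open>Arcs on a cycle\<close>

text \<open>Positions on the cycle of length \<open>m\<close> are integers, and all sets of positions are periodic. The
  elements of \<open>S\<close> are the starting points of arcs of length \<open>s\<close>.\<close>

definition no_cover :: "nat \<Rightarrow> int \<Rightarrow> int \<Rightarrow> int set \<Rightarrow> bool" where
  "no_cover k m s S \<longleftrightarrow> (\<forall>f c. (\<forall>i<k. f i \<in> S) \<longrightarrow>
     (\<exists>y\<in>{c..<c+m}. \<forall>i<k. y \<notin> {f i..<f i + s}))"

lemma no_coverD:
  assumes "no_cover k m s S" "\<And>i. i < k \<Longrightarrow> f i \<in> S"
    "\<And>y. c \<le> y \<Longrightarrow> y < c + m \<Longrightarrow> \<exists>i<k. f i \<le> y \<and> y < f i + s"
  shows False
  using assms unfolding no_cover_def by (metis atLeastLessThan_iff)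

definition periodic :: "int \<Rightarrow> int set \<Rightarrow> bool" where
  "periodic m S \<longleftrightarrow> (\<forall>a. a + m \<in> S \<longleftrightarrow> a \<in> S)"

text \<open>Advancing the window by one trades \<open>c\<close> for \<open>c + m\<close>, and by
  periodicity \<open>S\<close> contains both or neither.\<close>

lemma card_window:
  assumes "periodic m S" "m > 0"
  shows "card (S \<inter> {c..<c+m}) = card (S \<inter> {0..<m})"
proof -
  have step: "card (S \<inter> {c..<c+m}) = card (S \<inter> {c+1..<c+1+m})" for c
  proof -
    have 1: "{c..<c+m} = insert c {c+1..<c+m}" and 2: "{c+1..<c+1+m} = insert (c+m) {c+1..<c+m}"
      using \<open>m > 0\<close> by auto
    show ?thesis
      unfolding 1 2 using assms by (simp add: Int_insert_right periodic_def)
  qed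
  show ?thesis
  proof (induction c rule: int_induct[where k = 0])
    case base
    then show ?case by simp
  next
    case (step1 i)
    then show ?case using step[of i] by simp
  next
    case (step2 i)
    then show ?case using step[of "i - 1"] by simp
  qed
qed

lemma card_translate:
  assumes "periodic m S" "m > 0"
  shows "card ({x. b + x \<in> S} \<inter> {0..<m}) = card (S \<inter> {0..<m})"
proof -
  have "(+) b ` ({x. b + x \<in> S} \<inter> {0..<m}) = S \<inter> {b..<b+m}"
  proof (intro equalityI subsetI)
    fix x assume "x \<in> S \<inter> {b..<b+m}"
    then show "x \<in> (+) b ` ({x. b + x \<in> S} \<inter> {0..<m})"
      by (intro image_eqI[of _ _ "x - b"]) auto
  qed auto
  then have "card ({x. b + x \<in> S} \<inter> {0..<m}) = card (S \<inter> {b..<b+m})"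
    by (metis card_image inj_on_add)
  then show ?thesis using card_window[OF assms] by simp
qed

text \<open>The window in \<open>no_cover\<close> may start anywhere, so a translation merely moves
  it. With \<open>card_translate\<close> this allows a chosen start to be moved to position
  0.\<close>

lemma no_cover_translate:
  assumes "no_cover k m s S"
  shows "no_cover k m s {x. b + x \<in> S}"
  unfolding no_cover_def
proof (intro allI impI)
  fix f :: "nat \<Rightarrow> int" and c
  assume "\<forall>i<k. f i \<in> {x. b + x \<in> S}"
  then obtain y where "y \<in> {b+c..<b+c+m}" "\<forall>i<k. y \<notin> {b + f i..<b + f i + s}"
    using assms[unfolded no_cover_def, rule_format, of "\<lambda>i. b + f i" "b + c"] by auto
  then show "\<exists>y\<in>{c..<c+m}. \<forall>i<k. y \<notin> {f i..<f i + s}"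
    by (intro bexI[of _ "y - b"]) force+
qed

text \<open>Consecutive arcs from \<open>j\<close> on tile the interval; the one containing
  \<open>y\<close> has index \<open>(y - j) div s\<close>.\<close>

lemma progression_cell:
  fixes y j s :: int
  assumes "0 < s" "j \<le> y" "y < j + int K * s"
  obtains i where "i < K" "j + int i * s \<le> y" "y < j + int i * s + s"
proof -
  define i where "i = nat ((y - j) div s)"
  have i: "int i = (y - j) div s"
    using assms by (simp add: i_def pos_imp_zdiv_nonneg_iff)
  have "(y - j) div s * s + (y - j) mod s = y - j" "0 \<le> (y - j) mod s" "(y - j) mod s < s"
    using assms by (simp_all add: div_mult_mod_eq)
  then have cell: "j + int i * s \<le> y" "y < j + int i * s + s"
    unfolding i by linarith+
  have "int i * s < int K * s" using cell assms by linarith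
  then have "i < K" using assms by simp
  with cell show ?thesis using that by blast
qed

lemma progression_mod:
  fixes j s :: int
  assumes "1 \<le> j" "j \<le> s"
  shows "(j + int i * s - 1) mod s = j - 1"
proof -
  have "(j + int i * s - 1) mod s = (j - 1 + int i * s) mod s" by (simp add: algebra_simps)
  also have "\<dots> = j - 1" using assms by simp
  finally show ?thesis .
qed

text \<open>Otherwise all of \<open>j, j + s, j + 2s, \<dots>\<close> below \<open>m\<close> lie in \<open>S\<close>. If there are at least \<open>k\<close> of them,
  the first \<open>k\<close> arcs already wrap around the cycle; if not, they cover it together with the arc
  starting at \<open>0\<close>.\<close>

lemma class_has_gap:
  assumes nc: "no_cover k m s S" and "0 \<in> S" "1 \<le> j" "j \<le> s" "s < m" "m \<le> int k * s"
  shows "\<exists>x\<in>{1..<m} - S. (x - 1) mod s = j - 1"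
proof (rule ccontr)
  assume neg: "\<not> ?thesis"
  have "0 < s" using assms by linarith
  have chain: "j + int i * s \<in> S" if "j + int i * s < m" for i
  proof -
    have "0 \<le> int i * s" using \<open>0 < s\<close> by simp
    then have "j + int i * s \<in> {1..<m}" using that \<open>1 \<le> j\<close> by simp
    then show ?thesis using neg progression_mod[OF \<open>1 \<le> j\<close> \<open>j \<le> s\<close>, of i] by blast
  qed
  have "k \<noteq> 0" using assms by (intro notI) simp
  show False
  proof (cases "j + int (k - 1) * s < m")
    case True
    show False
    proof (rule no_coverD[OF nc, of "\<lambda>i. j + int i * s" j])
      fix i assume "i < k"
      then have "int i * s \<le> int (k - 1) * s"
        using \<open>0 < s\<close> by (intro mult_right_mono) auto
      then show "j + int i * s \<in> S" using True by (intro chain) simp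
    next
      fix y assume y: "j \<le> y" "y < j + m"
      then have "y < j + int k * s" using \<open>m \<le> int k * s\<close> by linarith
      then show "\<exists>i<k. j + int i * s \<le> y \<and> y < j + int i * s + s"
        using progression_cell[OF \<open>0 < s\<close> y(1)] by blast
    qed
  next
    case False
    \<comment> \<open>One arc covers \<open>[0, s)\<close>, the others follow the progression from
      \<open>j \<le> s\<close>. Indices past the window default to the start 0, which keeps
      \<open>f i\<close> in \<open>S\<close>; no \<open>y < m\<close> falls to them.\<close>
    define f where "f i = (if i = 0 then 0 else if j + int (i - 1) * s < m then j + int (i - 1) * s else 0)" for i
    show False
    proof (rule no_coverD[OF nc, of f 0])
      show "f i \<in> S" for i unfolding f_def using chain \<open>0 \<in> S\<close> by presburger
    next
      fix y assume y: "0 \<le> y" "y < 0 + m"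
      show "\<exists>i<k. f i \<le> y \<and> y < f i + s"
      proof (cases "y < s")
        case True
        then show ?thesis using y \<open>k \<noteq> 0\<close> by (intro exI[of _ 0]) (simp add: f_def)
      next
        case c: False
        have "j \<le> y" "y < j + int (k - 1) * s" using y False c \<open>j \<le> s\<close> by linarith+
        then obtain i where i: "i < k - 1" "j + int i * s \<le> y" "y < j + int i * s + s"
          using progression_cell[OF \<open>0 < s\<close>] by blast
        then have "f (i + 1) = j + int i * s" using y by (simp add: f_def)
        then show ?thesis using i by (intro exI[of _ "i + 1"]) simp
      qed
    qed
  qed
qed

text \<open>Each of the \<open>s\<close> classes contains a gap. The shift by one matches the
  classes \<open>j = 1, ..., s\<close> to the residues \<open>0, ..., s - 1\<close>.\<close>

lemma gaps_image:
  assumes "no_cover k m s S" "0 \<in> S" "1 \<le> s" "s < m" "m \<le> int k * s"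
  shows "(\<lambda>x. (x - 1) mod s) ` ({1..<m} - S) = {0..<s}"
proof
  show "(\<lambda>x. (x - 1) mod s) ` ({1..<m} - S) \<subseteq> {0..<s}" using assms by auto
  show "{0..<s} \<subseteq> (\<lambda>x. (x - 1) mod s) ` ({1..<m} - S)"
  proof
    fix y assume "y \<in> {0..<s}"
    then have "\<exists>x\<in>{1..<m} - S. (x - 1) mod s = (y + 1) - 1"
      using assms by (intro class_has_gap[of k m s S "y + 1"]) auto
    then show "y \<in> (\<lambda>x. (x - 1) mod s) ` ({1..<m} - S)" by force
  qed
qed

lemma card_gaps:
  assumes "0 \<in> S" "0 < (m::int)"
  shows "int (card (S \<inter> {0..<m})) = m - int (card ({1..<m} - S))"
proof -
  have "{0..<m} = insert 0 {1..<m}" using assms by auto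
  then have "{0..<m} - S = {1..<m} - S" using assms by simp
  moreover have "card {0..<m} = card ({0..<m} \<inter> S) + card ({0..<m} - S)"
    by (rule card_Int_Diff) simp
  ultimately show ?thesis using assms by (simp add: Int_commute)
qed

text \<open>Moving a start to 0 yields a gap in each of the \<open>s\<close> classes, so at least
  \<open>s\<close> of the \<open>m\<close> positions are not starts.\<close>

lemma card_starts_le:
  assumes nc: "no_cover k m s S" and per: "periodic m S" and "1 \<le> s" "s < m" "m \<le> int k * s"
  shows "int (card (S \<inter> {0..<m})) \<le> m - s"
proof (cases "S \<inter> {0..<m} = {}")
  case True
  then show ?thesis using assms by simp
next
  case False
  then obtain b where b: "b \<in> S" by auto
  let ?S = "{x. b + x \<in> S}"
  have "card {0..<s} \<le> card ({1..<m} - ?S)"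
  proof -
    have "(\<lambda>x. (x - 1) mod s) ` ({1..<m} - ?S) = {0..<s}"
      using b assms by (intro gaps_image[OF no_cover_translate[OF nc]]) auto
    then show ?thesis by (metis card_image_le finite_Diff finite_atLeastLessThan_int)
  qed
  then show ?thesis
    using card_gaps[of ?S m] b card_translate[OF per, of b] assms by simp
qed

text \<open>By the cardinality assumption every class modulo \<open>s\<close> has exactly one gap, so all of
  \<open>j - 1 + s, j - 1 + 2s, \<dots>\<close> lie in \<open>S\<close>. If \<open>j\<close> did as well, its arc would close the only hole
  these leave.\<close>

lemma gap_propagates:
  assumes nc: "no_cover k m s S" and "0 \<in> S" "2 \<le> j" "j \<le> s" "s < m" "m < int k * s" "2 \<le> k"
    and card: "int (card ({1..<m} - S)) = s" and gap: "j - 1 \<notin> S"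
  shows "j \<notin> S"
proof
  assume "j \<in> S"
  have "0 < s" using assms by linarith
  have img: "(\<lambda>x. (x - 1) mod s) ` ({1..<m} - S) = {0..<s}"
    using assms by (intro gaps_image[of k]) auto
  have inj: "inj_on (\<lambda>x. (x - 1) mod s) ({1..<m} - S)"
    using card \<open>0 < s\<close> by (intro eq_card_imp_inj_on) (auto simp: img)
  have chain: "j - 1 + int i * s \<in> S" if "j - 1 + int i * s < m" "i \<noteq> 0" for i
  proof (rule ccontr)
    assume neg: "\<not> ?thesis"
    have pos: "int i * s > 0" using that \<open>0 < s\<close> by (intro mult_pos_pos) auto
    have "(j - 1 + int i * s - 1) mod s = (j - 1 - 1) mod s"
      using progression_mod[of "j - 1" s i] \<open>2 \<le> j\<close> \<open>j \<le> s\<close> by simp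
    moreover have "j - 1 + int i * s \<in> {1..<m} - S" "j - 1 \<in> {1..<m} - S"
      using neg gap that pos \<open>2 \<le> j\<close> by auto
    ultimately have "j - 1 + int i * s = j - 1" using inj_onD[OF inj] by blast
    then show False using pos by linarith
  qed
  show False
  proof (cases "j - 1 + int (k - 1) * s < m")
    case True
    \<comment> \<open>This is the progression from \<open>j - 1\<close> with its first arc replaced
      by the one at \<open>j\<close>. It ends at \<open>j - 1 + k * s\<close>, which reaches
      \<open>j + m\<close> because \<open>m < k * s\<close> is strict.\<close>
    define f where "f i = (if i = 0 then j else j - 1 + int i * s)" for i
    show False
    proof (rule no_coverD[OF nc, of f j])
      fix i assume "i < k"
      then have "int i * s \<le> int (k - 1) * s"
        using \<open>0 < s\<close> by (intro mult_right_mono) auto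
      then have "j - 1 + int i * s < m" using True by linarith
      then show "f i \<in> S" using chain[of i] \<open>j \<in> S\<close> by (simp add: f_def)
    next
      fix y assume y: "j \<le> y" "y < j + m"
      show "\<exists>i<k. f i \<le> y \<and> y < f i + s"
      proof (cases "y < j + s")
        case True
        then show ?thesis using y \<open>2 \<le> k\<close> by (intro exI[of _ 0]) (simp add: f_def)
      next
        case False
        have "j - 1 \<le> y" "y < j - 1 + int k * s" using y \<open>m < int k * s\<close> by linarith+
        then obtain i where i: "i < k" "j - 1 + int i * s \<le> y" "y < j - 1 + int i * s + s"
          using progression_cell[OF \<open>0 < s\<close>] by blast
        then have "i \<noteq> 0" using False by (intro notI) simp
        then show ?thesis using i by (intro exI[of _ i]) (simp add: f_def)
      qed
    qed
  next
    case False
    \<comment> \<open>The arcs at 0 and \<open>j\<close> cover \<open>[0, j + s)\<close> as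
      \<open>j \<le> s\<close>; the progression from \<open>j - 1\<close> supplies the arcs beyond.
      The default is again the start 0.\<close>
    define f where "f i = (if i = 0 then 0 else if i = 1 then j
      else if j - 1 + int (i - 1) * s < m then j - 1 + int (i - 1) * s else 0)" for i
    show False
    proof (rule no_coverD[OF nc, of f 0])
      show "f i \<in> S" for i
        unfolding f_def using chain[of "i - 1"] \<open>0 \<in> S\<close> \<open>j \<in> S\<close> by simp
    next
      fix y assume y: "0 \<le> y" "y < 0 + m"
      consider "y < s" | "j \<le> y" "y < j + s" | "j + s \<le> y" using \<open>j \<le> s\<close> by linarith
      then show "\<exists>i<k. f i \<le> y \<and> y < f i + s"
      proof cases
        case 1
        then show ?thesis using y \<open>2 \<le> k\<close> by (intro exI[of _ 0]) (simp add: f_def)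
      next
        case 2
        then show ?thesis using y \<open>2 \<le> k\<close> by (intro exI[of _ 1]) (simp add: f_def)
      next
        case 3
        have "j - 1 \<le> y" "y < j - 1 + int (k - 1) * s" using y False 3 \<open>0 < s\<close> by linarith+
        then obtain i where i: "i < k - 1" "j - 1 + int i * s \<le> y" "y < j - 1 + int i * s + s"
          using progression_cell[OF \<open>0 < s\<close>] by blast
        then have "i \<noteq> 0" using 3 by (intro notI) simp
        then have "f (i + 1) = j - 1 + int i * s" using i y by (simp add: f_def)
        then show ?thesis using i by (intro exI[of _ "i + 1"]) simp
      qed
    qed
  qed
qed

text \<open>A start \<open>b\<close> followed by a gap exists, since \<open>S\<close> is neither
  empty nor everything. Propagation makes \<open>b + 1, ..., b + s\<close> gaps, and
  \<open>p = b + s\<close>. The excluded starts are exactly those whose arcs contain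
  \<open>p\<close>.\<close>

lemma starts_centered:
  assumes nc: "no_cover k m s S" and per: "periodic m S"
    and "1 \<le> s" "s < m" "m < int k * s" "2 \<le> k"
    and card: "int (card (S \<inter> {0..<m})) = m - s"
  shows "\<exists>p. \<forall>a\<in>{p-s<..p}. a \<notin> S"
proof -
  have "\<exists>b. b \<in> S \<and> b + 1 \<notin> S"
  proof (rule ccontr)
    assume neg: "\<not> ?thesis"
    have "S \<inter> {0..<m} \<noteq> {}" using card assms by (intro notI) simp
    then obtain b where b: "b \<in> S" by auto
    have "b + int i \<in> S" for i
      by (induction i) (use b neg in \<open>auto simp: algebra_simps\<close>)
    then have "y \<in> S" if "b \<le> y" for y
      using that by (metis zle_iff_zadd)
    then have "S \<inter> {b..<b+m} = {b..<b+m}" by auto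
    then show False using card card_window[OF per, of b] assms by simp
  qed
  then obtain b where b: "b \<in> S" "b + 1 \<notin> S" by auto
  let ?S = "{x. b + x \<in> S}"
  have "int (card ({1..<m} - ?S)) = s"
    using card_gaps[of ?S m] b card_translate[OF per, of b] assms by simp
  then have step: "b + j \<notin> S" if "2 \<le> j" "j \<le> s" "b + (j - 1) \<notin> S" for j
    using gap_propagates[OF no_cover_translate[OF nc, of b], of j] that b assms by simp
  have "b + j \<notin> S" if "1 \<le> j" "j \<le> s" for j
    using that by (induction j rule: int_ge_induct) (use b step in auto)
  from this[of "_ - b"] show ?thesis by (intro exI[of _ "b + s"]) auto
qed

subsection \<open>Independent sets of the perfect matching graph\<close>

definition opp :: "nat \<Rightarrow> nat \<Rightarrow> nat" where
  "opp n v = (if v \<le> n then v + n else v - n)"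

lemma finite_Mn_V [simp]: "finite (Mn_V n)" and card_Mn_V [simp]: "card (Mn_V n) = 2 * n"
  by (simp_all add: Mn_V_def)

lemma opp_in [simp]: "v \<in> Mn_V n \<Longrightarrow> opp n v \<in> Mn_V n"
  and opp_opp [simp]: "v \<in> Mn_V n \<Longrightarrow> opp n (opp n v) = v"
  and opp_neq [simp]: "v \<in> Mn_V n \<Longrightarrow> opp n v \<noteq> v"
  by (auto simp: opp_def Mn_V_def)

lemma opp_eq_iff [simp]: "v \<in> Mn_V n \<Longrightarrow> w \<in> Mn_V n \<Longrightarrow> opp n v = opp n w \<longleftrightarrow> v = w"
  by (metis opp_opp)

definition opp_free :: "nat \<Rightarrow> nat set \<Rightarrow> bool" where
  "opp_free n A \<longleftrightarrow> (\<forall>v\<in>A. opp n v \<notin> A)"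

lemma independent_Mn_iff:
  "independent (Mn_V n) (Mn_E n) A \<longleftrightarrow> A \<subseteq> Mn_V n \<and> opp_free n A"
proof
  assume A: "independent (Mn_V n) (Mn_E n) A"
  have "opp n v \<notin> A" if "v \<in> A" for v
  proof
    assume "opp n v \<in> A"
    have v: "v \<in> Mn_V n" using A that by (auto simp: independent_def)
    define i where "i = (if v \<le> n then v else v - n)"
    have "i \<in> {1..n}" "{i, n + i} \<subseteq> A"
      using v that \<open>opp n v \<in> A\<close> by (auto simp: i_def opp_def Mn_V_def add.commute)
    then show False using A by (auto simp: independent_def Mn_E_def)
  qed
  then show "A \<subseteq> Mn_V n \<and> opp_free n A" using A by (auto simp: independent_def opp_free_def)
next
  assume A: "A \<subseteq> Mn_V n \<and> opp_free n A"
  have "\<not> {i, n + i} \<subseteq> A" if "i \<in> {1..n}" for i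
    using A that by (auto simp: opp_free_def opp_def add.commute)
  then show "independent (Mn_V n) (Mn_E n) A" using A by (auto simp: independent_def Mn_E_def)
qed

definition edge_of :: "nat \<Rightarrow> nat \<Rightarrow> nat" where
  "edge_of n v = (if v \<le> n then v else v - n)"

lemma edge_of_in [simp]: "v \<in> Mn_V n \<Longrightarrow> edge_of n v \<in> {1..n}"
  by (auto simp: edge_of_def Mn_V_def)

lemma edge_of_eq_iff:
  "v \<in> Mn_V n \<Longrightarrow> w \<in> Mn_V n \<Longrightarrow> edge_of n v = edge_of n w \<longleftrightarrow> w = v \<or> w = opp n v"
  by (auto simp: edge_of_def opp_def Mn_V_def)

text \<open>Only \<open>v\<close> and \<open>opp n v\<close> share an edge index, so an
  \<open>opp_free\<close> set meets each edge at most once.\<close>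

lemma opp_free_inj_edge:
  assumes "A \<subseteq> Mn_V n" "opp_free n A"
  shows "inj_on (edge_of n) A"
proof (rule inj_onI)
  fix v w assume "v \<in> A" "w \<in> A" "edge_of n v = edge_of n w"
  then show "v = w" using assms edge_of_eq_iff[of v n w] by (auto simp: opp_free_def)
qed

lemma opp_free_card_le:
  assumes "A \<subseteq> Mn_V n" "opp_free n A"
  shows "card A \<le> n"
proof -
  have "edge_of n ` A \<subseteq> {1..n}" using assms edge_of_in by blast
  then show ?thesis
    using card_inj_on_le[OF opp_free_inj_edge[OF assms], of "{1..n}"] by simp
qed

lemma maximum_independent_Mn_iff:
  "maximum_independent (Mn_V n) (Mn_E n) A \<longleftrightarrow> A \<subseteq> Mn_V n \<and> opp_free n A \<and> card A = n"
proof -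
  have "{1..n} \<subseteq> Mn_V n" "opp_free n {1..n}"
    by (auto simp: Mn_V_def opp_free_def opp_def)
  then have "n \<le> card A" if "maximum_independent (Mn_V n) (Mn_E n) A"
    using that unfolding maximum_independent_def independent_Mn_iff
    by (metis card_atLeastAtMost add_diff_cancel_right' Suc_eq_plus1)
  then show ?thesis
    unfolding maximum_independent_def independent_Mn_iff
    using opp_free_card_le by (metis le_antisym)
qed

text \<open>A set contains a maximum independent set exactly when it meets every edge, that is, when
  its complement contains no edge. Both ranges of \<open>r\<close> are thereby reduced to
  \<open>opp_free\<close> sets.\<close>

lemma H_fam_Mn_iff:
  "A \<in> H_fam r (Mn_V n) (Mn_E n) \<longleftrightarrow>
     A \<subseteq> Mn_V n \<and> card A = r \<and> opp_free n (if r \<le> n then A else Mn_V n - A)"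
proof (cases "r \<le> n")
  case True
  have "A \<in> I_fam r (Mn_V n) (Mn_E n)" if "A \<in> M_fam r (Mn_V n) (Mn_E n)"
  proof -
    from that obtain S where S: "S \<subseteq> Mn_V n" "opp_free n S" "card S = n" "S \<subseteq> A"
        and A: "A \<subseteq> Mn_V n" "card A = r"
      unfolding M_fam_def maximum_independent_Mn_iff by auto
    have "finite A" using A finite_subset finite_Mn_V by blast
    then have "S = A" using S A True by (intro card_seteq) auto
    then show ?thesis using S A by (simp add: I_fam_def independent_Mn_iff)
  qed
  then show ?thesis using True by (auto simp: H_fam_def I_fam_def independent_Mn_iff)
next
  case False
  then have "A \<notin> I_fam r (Mn_V n) (Mn_E n)"
    using opp_free_card_le by (auto simp: I_fam_def independent_Mn_iff)
  moreover have "A \<in> M_fam r (Mn_V n) (Mn_E n) \<longleftrightarrow>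
      A \<subseteq> Mn_V n \<and> card A = r \<and> opp_free n (Mn_V n - A)"
  proof
    assume "A \<in> M_fam r (Mn_V n) (Mn_E n)"
    then obtain S where S: "S \<subseteq> Mn_V n" "opp_free n S" "card S = n" "S \<subseteq> A"
        and A: "A \<subseteq> Mn_V n" "card A = r"
      unfolding M_fam_def maximum_independent_Mn_iff by auto
    have "edge_of n ` S \<subseteq> {1..n}" using S(1) edge_of_in by blast
    moreover have "card (edge_of n ` S) = card {1..n}"
      using card_image[OF opp_free_inj_edge[OF S(1,2)]] S(3) by simp
    ultimately have "edge_of n ` S = {1..n}" by (intro card_subset_eq) simp_all
    have covered: "v \<in> S \<or> opp n v \<in> S" if "v \<in> Mn_V n" for v
    proof -
      obtain w where "w \<in> S" "edge_of n v = edge_of n w"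
        using edge_of_in[OF \<open>v \<in> Mn_V n\<close>] \<open>edge_of n ` S = {1..n}\<close> by blast
      then show ?thesis using edge_of_eq_iff[OF \<open>v \<in> Mn_V n\<close>, of w] S(1) by auto
    qed
    then show "A \<subseteq> Mn_V n \<and> card A = r \<and> opp_free n (Mn_V n - A)"
      using S(4) A by (auto simp: opp_free_def)
  next
    assume A: "A \<subseteq> Mn_V n \<and> card A = r \<and> opp_free n (Mn_V n - A)"
    \<comment> \<open>One end is kept per edge: the one in \<open>{1..n}\<close> if it lies in
      \<open>A\<close>, otherwise the other.\<close>
    define S where "S = {v \<in> A. v \<le> n \<or> opp n v \<notin> A}"
    have SV: "S \<subseteq> Mn_V n" using A by (auto simp: S_def)
    have "opp n v \<notin> S" if "v \<in> S" for v
      using that SV A by (auto simp: S_def opp_def Mn_V_def split: if_splits)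
    then have free: "opp_free n S" by (simp add: opp_free_def)
    have "{1..n} \<subseteq> edge_of n ` S"
    proof
      fix i assume i: "i \<in> {1..n}"
      then have "i \<in> Mn_V n" by (auto simp: Mn_V_def)
      then have "i \<in> A \<or> opp n i \<in> A" using A by (auto simp: opp_free_def)
      then have "i \<in> S \<or> opp n i \<in> S \<and> i \<notin> A" using i \<open>i \<in> Mn_V n\<close> by (auto simp: S_def)
      then show "i \<in> edge_of n ` S"
      proof
        assume "i \<in> S"
        then show ?thesis using i by (intro image_eqI[of _ _ i]) (auto simp: edge_of_def)
      next
        assume "opp n i \<in> S \<and> i \<notin> A"
        then show ?thesis using i by (intro image_eqI[of _ _ "opp n i"]) (auto simp: edge_of_def opp_def)
      qed
    qed
    moreover have "finite S" using SV finite_subset finite_Mn_V by blast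
    ultimately have "card {1..n} \<le> card S" by (rule surj_card_le[rotated])
    then have "card S = n" using opp_free_card_le[OF SV free] by simp
    then show "A \<in> M_fam r (Mn_V n) (Mn_E n)"
      using A SV free unfolding M_fam_def maximum_independent_Mn_iff by (auto simp: S_def)
  qed
  ultimately show ?thesis using False by (simp add: H_fam_def)
qed

subsection \<open>The size of a star\<close>

definition opp_free_sets :: "nat \<Rightarrow> nat set \<Rightarrow> nat \<Rightarrow> nat set set" where
  "opp_free_sets n U t = {A. A \<subseteq> U \<and> opp_free n A \<and> card A = t}"

lemma finite_opp_free_sets: "finite U \<Longrightarrow> finite (opp_free_sets n U t)"
  by (simp add: opp_free_sets_def)

lemma card_opp_free_sets_star:
  assumes U: "U \<subseteq> Mn_V n" and x: "x \<in> U"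
  shows "card {A \<in> opp_free_sets n U (Suc t). x \<in> A} = card (opp_free_sets n (U - {x, opp n x}) t)"
proof -
  have fin: "finite B" if "B \<subseteq> U" for B
    using finite_subset[OF that finite_subset[OF U finite_Mn_V]] .
  have xV: "x \<in> Mn_V n" using U x by auto
  have "bij_betw (insert x) (opp_free_sets n (U - {x, opp n x}) t) {A \<in> opp_free_sets n U (Suc t). x \<in> A}"
  proof (rule bij_betw_byWitness[where f' = "\<lambda>A. A - {x}"])
    show "\<forall>B\<in>opp_free_sets n (U - {x, opp n x}) t. insert x B - {x} = B"
      by (auto simp: opp_free_sets_def)
    show "\<forall>A\<in>{A \<in> opp_free_sets n U (Suc t). x \<in> A}. insert x (A - {x}) = A" by auto
    show "insert x ` opp_free_sets n (U - {x, opp n x}) t \<subseteq> {A \<in> opp_free_sets n U (Suc t). x \<in> A}"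
    proof (rule image_subsetI)
      fix B assume B: "B \<in> opp_free_sets n (U - {x, opp n x}) t"
      then have BU: "B \<subseteq> U" "x \<notin> B" "opp n x \<notin> B" "finite B"
        using fin by (auto simp: opp_free_sets_def)
      have "opp n v \<noteq> x" if "v \<in> B" for v
        using that BU U opp_opp[of v n] by auto
      then show "insert x B \<in> {A \<in> opp_free_sets n U (Suc t). x \<in> A}"
        using B BU x xV by (auto simp: opp_free_sets_def opp_free_def)
    qed
    show "(\<lambda>A. A - {x}) ` {A \<in> opp_free_sets n U (Suc t). x \<in> A} \<subseteq> opp_free_sets n (U - {x, opp n x}) t"
      by (auto simp: opp_free_sets_def opp_free_def)
  qed
  then show ?thesis by (rule bij_betw_same_card[symmetric])
qed

text \<open>The formula chooses \<open>t\<close> of \<open>q\<close> edges and an end of each. The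
  induction singles out an edge \<open>{x, opp n x}\<close>: sets through \<open>x\<close>, sets
  through \<open>opp n x\<close> and sets avoiding both combine by Pascal's rule.\<close>

lemma card_opp_free_sets:
  assumes "U \<subseteq> Mn_V n" "\<And>v. v \<in> U \<Longrightarrow> opp n v \<in> U" "card U = 2 * q"
  shows "card (opp_free_sets n U t) = 2 ^ t * (q choose t)"
  using assms
proof (induction q arbitrary: U t)
  case 0
  then have "U = {}" using finite_subset[OF 0(1)] by simp
  then have "opp_free_sets n U t = (if t = 0 then {{}} else {})"
    by (auto simp: opp_free_sets_def opp_free_def)
  then show ?case by simp
next
  case (Suc q)
  have finU: "finite U" using Suc.prems finite_subset[OF _ finite_Mn_V] by blast
  show ?case
  proof (cases t)
    case 0
    have "opp_free_sets n U t = {{}}"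
      using finU finite_subset by (fastforce simp: opp_free_sets_def opp_free_def 0)
    then show ?thesis by (simp add: 0)
  next
    case (Suc t')
    obtain x where x: "x \<in> U" using Suc.prems by fastforce
    have xV: "x \<in> Mn_V n" and ox: "opp n x \<in> U" using x Suc.prems by auto
    define U' where "U' = U - {x, opp n x}"
    have "card U' = 2 * q"
      using Suc.prems(3) x ox opp_neq[OF xV] finU unfolding U'_def
      by (subst card_Diff_subset) (auto simp: card_insert_if)
    moreover have "opp n v \<in> U'" if "v \<in> U'" for v
    proof -
      have "v \<in> Mn_V n" using that Suc.prems(1) by (auto simp: U'_def)
      then show ?thesis using that Suc.prems(2)[of v] opp_opp[of v n] opp_opp[OF xV] xV
        by (auto simp: U'_def)
    qed
    ultimately have IH: "card (opp_free_sets n U' t) = 2 ^ t * (q choose t)" for t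
      using Suc.prems(1) by (intro Suc.IH) (auto simp: U'_def)
    let ?X = "{A \<in> opp_free_sets n U t. x \<in> A}"
    let ?Y = "{A \<in> opp_free_sets n U t. opp n x \<in> A}"
    have "opp_free_sets n U t = ?X \<union> ?Y \<union> opp_free_sets n U' t"
      by (auto simp: opp_free_sets_def U'_def)
    moreover have "card (?X \<union> ?Y \<union> opp_free_sets n U' t) = card ?X + card ?Y + card (opp_free_sets n U' t)"
    proof -
      have fin: "finite (opp_free_sets n U t)" "finite (opp_free_sets n U' t)"
        using finU by (simp_all add: finite_opp_free_sets U'_def)
      have "?X \<inter> ?Y = {}" by (auto simp: opp_free_sets_def opp_free_def)
      then have "card (?X \<union> ?Y) = card ?X + card ?Y" using fin by (intro card_Un_disjoint) simp_all
      moreover have "(?X \<union> ?Y) \<inter> opp_free_sets n U' t = {}" by (auto simp: opp_free_sets_def U'_def)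
      then have "card (?X \<union> ?Y \<union> opp_free_sets n U' t) = card (?X \<union> ?Y) + card (opp_free_sets n U' t)"
        using fin by (intro card_Un_disjoint) simp_all
      ultimately show ?thesis by simp
    qed
    moreover have "card ?X = card (opp_free_sets n U' t')"
      using card_opp_free_sets_star[OF Suc.prems(1) x, of t'] by (simp add: Suc U'_def)
    moreover have "card ?Y = card (opp_free_sets n U' t')"
      using card_opp_free_sets_star[OF Suc.prems(1) ox, of t'] opp_opp[OF xV]
      by (simp add: Suc U'_def insert_commute)
    ultimately show ?thesis by (simp add: IH Suc algebra_simps)
  qed
qed

text \<open>For \<open>r > n\<close> the complement of a member has size
  \<open>s = 2 * n - r\<close> and misses \<open>x\<close>; it contains \<open>opp n x\<close> or
  misses the whole edge. Binomial symmetry turns these two counts into the summands of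
  \<open>bound\<close>.\<close>

lemma card_H_star:
  assumes n: "1 \<le> n" and r: "1 \<le> r" "r < 2 * n" and x: "x \<in> Mn_V n"
  shows "card (H_star r (Mn_V n) (Mn_E n) x) = bound n r"
proof -
  let ?V = "Mn_V n"
  let ?U = "?V - {x, opp n x}"
  have U: "card ?U = 2 * (n - 1)"
    using x opp_neq[OF x, symmetric] by (subst card_Diff_subset) (auto simp: card_insert_if)
  have cU: "card (opp_free_sets n ?U t) = 2 ^ t * ((n - 1) choose t)" for t
  proof (rule card_opp_free_sets[OF _ _ U])
    fix v assume "v \<in> ?U"
    then show "opp n v \<in> ?U" using opp_opp[of v n] opp_opp[OF x] x by auto
  qed auto
  show ?thesis
  proof (cases "r \<le> n")
    case True
    have "H_star r ?V (Mn_E n) x = {A \<in> opp_free_sets n ?V (Suc (r - 1)). x \<in> A}"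
      using True r by (auto simp: H_star_def H_fam_Mn_iff opp_free_sets_def)
    then show ?thesis
      using True card_opp_free_sets_star[of ?V n x "r - 1"] x cU by (simp add: bound_def)
  next
    case False
    define s where "s = 2 * n - r"
    have s: "1 \<le> s" "s < n" using r False by (auto simp: s_def)
    let ?Y = "{A \<in> opp_free_sets n ?V s. opp n x \<in> A}"
    have "bij_betw (\<lambda>A. ?V - A) (H_star r ?V (Mn_E n) x) (?Y \<union> opp_free_sets n ?U s)"
    proof (rule bij_betw_byWitness[where f' = "\<lambda>A. ?V - A"])
      show "(\<lambda>A. ?V - A) ` H_star r ?V (Mn_E n) x \<subseteq> ?Y \<union> opp_free_sets n ?U s"
        using False x
        by (auto simp: H_star_def H_fam_Mn_iff opp_free_sets_def card_Diff_subset finite_subset[OF _ finite_Mn_V] s_def)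
      show "(\<lambda>A. ?V - A) ` (?Y \<union> opp_free_sets n ?U s) \<subseteq> H_star r ?V (Mn_E n) x"
      proof (rule image_subsetI)
        fix B assume B: "B \<in> ?Y \<union> opp_free_sets n ?U s"
        then have BV: "B \<subseteq> ?V" "opp_free n B" "card B = s" by (auto simp: opp_free_sets_def)
        then have "x \<notin> B" using B x by (auto simp: opp_free_sets_def opp_free_def)
        moreover have "card (?V - B) = r"
          using BV r by (simp add: card_Diff_subset finite_subset[OF _ finite_Mn_V] s_def)
        moreover have "?V - (?V - B) = B" using BV by auto
        ultimately show "?V - B \<in> H_star r ?V (Mn_E n) x"
          using False x BV by (simp add: H_star_def H_fam_Mn_iff)
      qed
    qed (auto simp: H_star_def H_fam_Mn_iff opp_free_sets_def)
    then have "card (H_star r ?V (Mn_E n) x) = card (?Y \<union> opp_free_sets n ?U s)"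
      by (rule bij_betw_same_card)
    also have "\<dots> = card ?Y + card (opp_free_sets n ?U s)"
      by (rule card_Un_disjoint) (simp_all add: finite_opp_free_sets, auto simp: opp_free_sets_def)
    also have "card ?Y = card (opp_free_sets n ?U (s - 1))"
      using card_opp_free_sets_star[of ?V n "opp n x" "s - 1"] x s by (simp add: insert_commute)
    also have "\<dots> = 2 ^ (s - 1) * ((n - 1) choose (r - n))"
    proof -
      have "n - 1 - (r - n) = s - 1" "r - n \<le> n - 1" using s r False by (auto simp: s_def)
      then show ?thesis using binomial_symmetric[of "r - n" "n - 1"] by (simp add: cU)
    qed
    also have "card (opp_free_sets n ?U s) = 2 ^ s * ((n - 1) choose (r - n - 1))"
    proof -
      have "n - 1 - (r - n - 1) = s" "r - n - 1 \<le> n - 1" using s r False by (auto simp: s_def)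
      then show ?thesis using binomial_symmetric[of "r - n - 1" "n - 1"] by (simp add: cU)
    qed
    finally show ?thesis using False by (simp add: bound_def s_def)
  qed
qed

subsection \<open>Placements of the vertices on a cycle\<close>

text \<open>A frame places the vertices on the cycle \<open>\<int> / 2n\<close> with opposite vertices antipodal. It is given
  as a function on \<open>\<int>\<close>; its periodicity and surjectivity follow from the conditions.\<close>

definition frame :: "nat \<Rightarrow> (int \<Rightarrow> nat) \<Rightarrow> bool" where
  "frame n \<sigma> \<longleftrightarrow> (\<forall>i. \<sigma> (i + int n) = opp n (\<sigma> i)) \<and> range \<sigma> \<subseteq> Mn_V n \<and>
     (\<forall>i j. \<sigma> i = \<sigma> j \<longrightarrow> 2 * int n dvd i - j)"

lemma frame_in [simp]: "frame n \<sigma> \<Longrightarrow> \<sigma> i \<in> Mn_V n"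
  and frame_half: "frame n \<sigma> \<Longrightarrow> \<sigma> (i + int n) = opp n (\<sigma> i)"
  by (auto simp: frame_def)

lemma frame_period:
  assumes "frame n \<sigma>"
  shows "\<sigma> (i + 2 * int n) = \<sigma> i"
proof -
  have "\<sigma> (i + 2 * int n) = \<sigma> (i + int n + int n)" by (simp add: algebra_simps)
  also have "\<dots> = \<sigma> i" using assms by (simp only: frame_half frame_in opp_opp)
  finally show ?thesis .
qed

lemma frame_period_mult:
  assumes "frame n \<sigma>"
  shows "\<sigma> (i + 2 * int n * q) = \<sigma> i"
proof (induction q rule: int_induct[where k = 0])
  case (step1 q)
  have "i + 2 * int n * (q + 1) = (i + 2 * int n * q) + 2 * int n" by (simp add: distrib_left)
  then show ?case using step1 frame_period[OF assms] by metis
next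
  case (step2 q)
  have "i + 2 * int n * q = (i + 2 * int n * (q - 1)) + 2 * int n" by (simp add: right_diff_distrib)
  then show ?case using step2 frame_period[OF assms] by metis
qed simp

lemma frame_eq_iff:
  assumes "frame n \<sigma>"
  shows "\<sigma> i = \<sigma> j \<longleftrightarrow> 2 * int n dvd i - j"
proof
  assume "2 * int n dvd i - j"
  then obtain q where "i - j = 2 * int n * q" by (elim dvdE)
  then have "i = j + 2 * int n * q" by simp
  then show "\<sigma> i = \<sigma> j" using frame_period_mult[OF assms] by metis
qed (use assms in \<open>auto simp: frame_def\<close>)

lemma frame_inj:
  assumes "frame n \<sigma>" "T \<subseteq> {c..<c + 2 * int n}"
  shows "inj_on \<sigma> T"
proof (rule inj_onI)
  fix i j assume ij: "i \<in> T" "j \<in> T" "\<sigma> i = \<sigma> j"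
  then have "2 * int n dvd i - j" using frame_eq_iff[OF assms(1)] by blast
  moreover have "\<bar>i - j\<bar> < 2 * int n"
    using subsetD[OF assms(2) ij(1)] subsetD[OF assms(2) ij(2)] by auto
  ultimately show "i = j" using dvd_imp_le_int[of "i - j" "2 * int n"] by fastforce
qed

lemma frame_image:
  assumes "frame n \<sigma>"
  shows "\<sigma> ` {c..<c + 2 * int n} = Mn_V n"
proof (rule card_subset_eq)
  show "\<sigma> ` {c..<c + 2 * int n} \<subseteq> Mn_V n" using assms by auto
  show "card (\<sigma> ` {c..<c + 2 * int n}) = card (Mn_V n)"
    using card_image[OF frame_inj[OF assms order_refl]] by simp
qed simp

lemma frame_mem_image:
  assumes "frame n \<sigma>" "T \<subseteq> {c..<c + 2 * int n}" "y \<in> {c..<c + 2 * int n}"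
  shows "\<sigma> y \<in> \<sigma> ` T \<longleftrightarrow> y \<in> T"
  using inj_on_image_mem_iff[OF frame_inj[OF assms(1) order_refl] assms(3,2)] .

lemma frame_complement:
  assumes "frame n \<sigma>" "T \<subseteq> {c..<c + 2 * int n}"
  shows "Mn_V n - \<sigma> ` T = \<sigma> ` ({c..<c + 2 * int n} - T)"
  using inj_on_image_set_diff[OF frame_inj[OF assms(1) order_refl[of "{c..<c + 2 * int n}"]], of "{c..<c + 2 * int n}" T] assms
  by (simp add: frame_image[OF assms(1)])

lemma frame_shift: "frame n \<sigma> \<Longrightarrow> frame n (\<lambda>i. \<sigma> (i + p))"
  unfolding frame_def
  by (auto simp: add.assoc add.commute[of p]) (metis add.assoc add.commute add_diff_cancel_right)+

subsection \<open>Averaging over automorphisms\<close>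

definition automorphisms :: "nat \<Rightarrow> (nat \<Rightarrow> nat) set" where
  "automorphisms n = {g. g permutes Mn_V n \<and> (\<forall>v\<in>Mn_V n. g (opp n v) = opp n (g v))}"

lemma finite_automorphisms: "finite (automorphisms n)"
  using finite_permutations[of "Mn_V n"] by (auto simp: automorphisms_def)

lemma automorphisms_comp:
  "g \<in> automorphisms n \<Longrightarrow> h \<in> automorphisms n \<Longrightarrow> g \<circ> h \<in> automorphisms n"
  by (auto simp: automorphisms_def permutes_compose permutes_in_image)

lemma automorphisms_inv:
  assumes "g \<in> automorphisms n"
  shows "inv g \<in> automorphisms n"
proof -
  have g: "g permutes Mn_V n" and opp: "\<And>v. v \<in> Mn_V n \<Longrightarrow> g (opp n v) = opp n (g v)"
    using assms by (auto simp: automorphisms_def)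
  have "inv g (opp n v) = opp n (inv g v)" if "v \<in> Mn_V n" for v
  proof -
    have "inv g v \<in> Mn_V n" using that permutes_in_image[OF permutes_inv[OF g]] by blast
    then have "g (opp n (inv g v)) = opp n v" using opp permutes_inverses[OF g] by simp
    then show ?thesis using permutes_inverses[OF g] by metis
  qed
  then show ?thesis using permutes_inv[OF g] by (auto simp: automorphisms_def)
qed

lemma frame_automorphism:
  assumes "frame n \<sigma>" "g \<in> automorphisms n"
  shows "frame n (g \<circ> \<sigma>)"
proof -
  have "inj g" using assms(2) permutes_inj by (auto simp: automorphisms_def)
  then show ?thesis
    using assms by (auto simp: frame_def automorphisms_def permutes_in_image inj_eq)
qed

text \<open>Positions with the same vertex under \<open>\<rho>\<close> differ by a multiple of
  \<open>2 * n\<close>, hence have the same vertex under \<open>\<sigma>\<close>, and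
  \<open>g\<close> is well defined. So automorphisms act transitively on frames.\<close>

lemma automorphism_of_frame:
  assumes "1 \<le> n" "frame n \<rho>" "frame n \<sigma>"
  obtains g where "g \<in> automorphisms n" "\<And>i. g (\<rho> i) = \<sigma> i"
proof -
  define g where "g v = (if v \<in> Mn_V n then \<sigma> (inv \<rho> v) else v)" for v
  have g: "g (\<rho> i) = \<sigma> i" for i
  proof -
    have "\<rho> (inv \<rho> (\<rho> i)) = \<rho> i" by (simp add: f_inv_into_f)
    then have "\<sigma> (inv \<rho> (\<rho> i)) = \<sigma> i" using assms by (simp add: frame_eq_iff)
    then show ?thesis using assms by (simp add: g_def)
  qed
  have "g ` Mn_V n = Mn_V n"
    using frame_image[OF assms(2), of 0] frame_image[OF assms(3), of 0] g
    by (metis (mono_tags, lifting) image_cong image_image)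
  then have "bij_betw g (Mn_V n) (Mn_V n)"
    using eq_card_imp_inj_on[of "Mn_V n" g] by (simp add: bij_betw_def)
  then have "g permutes Mn_V n" by (rule bij_imp_permutes) (simp add: g_def)
  moreover have "g (opp n v) = opp n (g v)" if "v \<in> Mn_V n" for v
  proof -
    obtain i where "v = \<rho> i" using \<open>v \<in> Mn_V n\<close> frame_image[OF assms(2), of 0] by blast
    then show ?thesis using g frame_half[OF assms(2)] frame_half[OF assms(3)] by metis
  qed
  ultimately have "g \<in> automorphisms n" by (simp add: automorphisms_def)
  then show ?thesis using that g by blast
qed

text \<open>One end of each edge fills the positions \<open>0, ..., n - 1\<close>. The antipodal
  rule forces the rest: blocks of length \<open>n\<close> alternate between \<open>u\<close> and its
  opposites.\<close>

lemma frame_of_transversal: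
  assumes n: "1 \<le> n" and u: "\<And>i. i < n \<Longrightarrow> u i \<in> Mn_V n" and inj: "inj_on (edge_of n \<circ> u) {..<n}"
  obtains \<sigma> where "frame n \<sigma>" "\<And>i. i < n \<Longrightarrow> \<sigma> (int i) = u i"
proof -
  define \<sigma> where "\<sigma> x = (if even (x div int n) then id else opp n) (u (nat (x mod int n)))" for x
  have u': "u (nat (x mod int n)) \<in> Mn_V n" for x
    using n by (intro u) (simp add: nat_less_iff)
  have "\<sigma> (x + int n) = opp n (\<sigma> x)" for x
  proof -
    have "(x + int n) div int n = x div int n + 1" using n by (intro div_add_self2) simp
    then show ?thesis using u'[of x] by (simp add: \<sigma>_def)
  qed
  moreover have "range \<sigma> \<subseteq> Mn_V n" using u' by (auto simp: \<sigma>_def)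
  moreover have "2 * int n dvd x - y" if eq: "\<sigma> x = \<sigma> y" for x y
  proof -
    let ?x = "nat (x mod int n)" and ?y = "nat (y mod int n)"
    have lt: "?x < n" "?y < n" using n by (simp_all add: nat_less_iff)
    have edge: "edge_of n (opp n v) = edge_of n v" if "v \<in> Mn_V n" for v
      using edge_of_eq_iff[of "opp n v" n v] that by simp
    have "edge_of n (\<sigma> x) = edge_of n (u ?x)" "edge_of n (\<sigma> y) = edge_of n (u ?y)"
      using edge u' by (simp_all add: \<sigma>_def)
    then have "(edge_of n \<circ> u) ?x = (edge_of n \<circ> u) ?y" using eq by simp
    then have "?x = ?y" using inj_onD[OF inj] lt by blast
    then have xy: "x mod int n = y mod int n"
      using eq_nat_nat_iff[of "x mod int n" "y mod int n"] n by simp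
    have "even (x div int n) = even (y div int n)"
    proof (rule ccontr)
      assume "even (x div int n) \<noteq> even (y div int n)"
      then have "{\<sigma> x, \<sigma> y} = {u ?y, opp n (u ?y)}"
        by (cases "even (x div int n)") (auto simp: \<sigma>_def xy)
      then show False using eq opp_neq[OF u'[of y]] by (metis insert_absorb2 singletonI insertI1 insertI2 singletonD)
    qed
    then have "even (x div int n - y div int n)" by simp
    then obtain q where q: "x div int n - y div int n = 2 * q" by (elim evenE)
    have "x - y = (x div int n - y div int n) * int n"
      unfolding left_diff_distrib
      using div_mult_mod_eq[of x "int n"] div_mult_mod_eq[of y "int n"] xy by linarith
    then show ?thesis by (simp add: q)
  qed
  ultimately have "frame n \<sigma>" by (simp add: frame_def)
  moreover have "\<sigma> (int i) = u i" if "i < n" for i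
    using that by (simp add: \<sigma>_def)
  ultimately show ?thesis using that by blast
qed

text \<open>\<open>A\<close> is placed first, followed by one end of every edge that it misses; the
  edge index itself serves as this end.\<close>

lemma frame_through_opp_free:
  assumes n: "1 \<le> n" and A: "A \<subseteq> Mn_V n" "opp_free n A"
  obtains \<sigma> where "frame n \<sigma>" "A = \<sigma> ` {0..<int (card A)}"
proof -
  define t where "t = card A"
  have fin: "finite A" using finite_subset[OF A(1)] by simp
  have tn: "t \<le> n" using opp_free_card_le[OF A] by (simp add: t_def)
  obtain h where h: "bij_betw h {0..<t} A"
    using ex_bij_betw_nat_finite[OF fin] by (auto simp: t_def)
  let ?R = "{1..n} - edge_of n ` A"
  have "edge_of n ` A \<subseteq> {1..n}" using A(1) edge_of_in by blast
  then have "card ?R = n - t"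
    using card_image[OF opp_free_inj_edge[OF A]] fin by (simp add: card_Diff_subset t_def)
  then obtain h' where h': "bij_betw h' {0..<n - t} ?R"
    using ex_bij_betw_nat_finite[of ?R] by auto
  define u where "u i = (if i < t then h i else h' (i - t))" for i
  have uA: "u i \<in> A" if "i < t" for i using that h by (auto simp: u_def bij_betw_def)
  have uR: "u i \<in> ?R" if "t \<le> i" "i < n" for i
    using that h' bij_betwE[OF h'] by (auto simp: u_def)
  have RV: "?R \<subseteq> Mn_V n" by (auto simp: Mn_V_def)
  have eR: "edge_of n v = v" if "v \<in> ?R" for v using that by (auto simp: edge_of_def)
  have uV: "u i \<in> Mn_V n" if "i < n" for i
    using that uA[of i] uR[of i] A RV by (meson not_less subsetD)
  have lt_ne: "edge_of n (u i) \<noteq> edge_of n (u j)" if "i < t" "t \<le> j" "j < n" for i j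
    using uA[OF that(1)] uR[OF that(2,3)] eR[OF uR[OF that(2,3)]] by (metis DiffD2 imageI)
  have "inj_on (edge_of n \<circ> u) {..<n}"
  proof (rule inj_onI)
    fix i j assume ij: "i \<in> {..<n}" "j \<in> {..<n}" "(edge_of n \<circ> u) i = (edge_of n \<circ> u) j"
    consider "i < t" "j < t" | "t \<le> i" "t \<le> j" | "i < t" "t \<le> j" | "t \<le> i" "j < t" by linarith
    then show "i = j"
    proof cases
      case 1
      then have "h i = h j"
        using ij uA[of i] uA[of j] inj_onD[OF opp_free_inj_edge[OF A]] by (auto simp: u_def)
      then show ?thesis using 1 h by (auto simp: bij_betw_def inj_on_def)
    next
      case 2
      then have "u i = u j" using ij eR uR by (metis comp_apply lessThan_iff)
      then have "h' (i - t) = h' (j - t)" using 2 by (simp add: u_def)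
      moreover have "i - t \<in> {0..<n - t}" "j - t \<in> {0..<n - t}" using 2 ij by auto
      ultimately have "i - t = j - t" using bij_betw_imp_inj_on[OF h'] by (meson inj_onD)
      then show ?thesis using 2 by simp
    next
      case 3
      then show ?thesis using lt_ne[of i j] ij by simp
    next
      case 4
      then show ?thesis using lt_ne[of j i] ij by simp
    qed
  qed
  then obtain \<sigma> where \<sigma>: "frame n \<sigma>" "\<And>i. i < n \<Longrightarrow> \<sigma> (int i) = u i"
    using frame_of_transversal[OF n, of u] uV by metis
  have "\<sigma> ` {0..<int t} = \<sigma> ` int ` {0..<t}" by (simp add: image_int_atLeastLessThan)
  also have "\<dots> = (\<lambda>i. h i) ` {0..<t}"
    unfolding image_image using \<sigma>(2) tn by (intro image_cong) (auto simp: u_def)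
  also have "\<dots> = A" using h by (simp add: bij_betw_def)
  finally show ?thesis using that \<sigma>(1) by (simp add: t_def)
qed

text \<open>Opposite vertices sit \<open>n\<close> positions apart modulo \<open>2 * n\<close>,
  which cannot happen inside an interval of length \<open>n\<close>.\<close>

lemma frame_opp_free_arc:
  assumes "frame n \<sigma>" "T \<subseteq> {c..<c + int n}"
  shows "opp_free n (\<sigma> ` T)"
proof -
  have "opp n (\<sigma> i) \<noteq> \<sigma> j" if "i \<in> T" "j \<in> T" for i j
  proof
    assume "opp n (\<sigma> i) = \<sigma> j"
    then have d: "2 * int n dvd i + int n - j"
      using frame_half[OF assms(1)] frame_eq_iff[OF assms(1)] by metis
    have "0 < i + int n - j" "i + int n - j < 2 * int n"
      using subsetD[OF assms(2) that(1)] subsetD[OF assms(2) that(2)] by auto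
    then show False using zdvd_imp_le[OF d] by simp
  qed
  then show ?thesis by (auto simp: opp_free_def)
qed


section \<open>Arcs whose complements belong to the family\<close>

definition starts :: "nat \<Rightarrow> nat \<Rightarrow> nat set set \<Rightarrow> (int \<Rightarrow> nat) \<Rightarrow> int set" where
  "starts n s F \<sigma> = {a. Mn_V n - \<sigma> ` {a..<a + int s} \<in> F}"

lemma arc_period:
  assumes "frame n \<sigma>"
  shows "\<sigma> ` {a + 2 * int n..<a + 2 * int n + t} = \<sigma> ` {a..<a + t}"
proof -
  have "(\<lambda>x. x + 2 * int n) ` {a..<a + t} = {a + 2 * int n..<a + 2 * int n + t}"
    by (simp add: image_add_atLeastLessThan' algebra_simps)
  then have "\<sigma> ` {a + 2 * int n..<a + 2 * int n + t} = (\<lambda>x. \<sigma> (x + 2 * int n)) ` {a..<a + t}"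
    by (metis image_image)
  then show ?thesis by (simp add: frame_period[OF assms])
qed

lemma periodic_starts: "frame n \<sigma> \<Longrightarrow> periodic (2 * int n) (starts n s F \<sigma>)"
  by (simp add: periodic_def starts_def arc_period)

lemma arc_complement:
  assumes "frame n \<sigma>" "s \<le> 2 * n"
  shows "Mn_V n - \<sigma> ` {a..<a + int s} = \<sigma> ` {a + int s..<a + 2 * int n}"
proof -
  have "{a..<a + 2 * int n} - {a..<a + int s} = {a + int s..<a + 2 * int n}" using assms by auto
  then show ?thesis using frame_complement[OF assms(1), of "{a..<a + int s}" a] assms by simp
qed

text \<open>Either the complementary arc, of length \<open>r \<le> n\<close>, or the arc itself, of
  length \<open>s < n\<close>, is short enough to be \<open>opp_free\<close>.\<close>

lemma arc_complement_in_H: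
  assumes \<sigma>: "frame n \<sigma>" and rs: "r + s = 2 * n"
  shows "Mn_V n - \<sigma> ` {a..<a + int s} \<in> H_fam r (Mn_V n) (Mn_E n)"
proof -
  have sub: "{a..<a + int s} \<subseteq> {a..<a + 2 * int n}" using rs by auto
  have "card (\<sigma> ` {a..<a + int s}) = s"
    using card_image[OF frame_inj[OF \<sigma> sub]] by simp
  moreover have "\<sigma> ` {a..<a + int s} \<subseteq> Mn_V n" using \<sigma> by auto
  ultimately have "card (Mn_V n - \<sigma> ` {a..<a + int s}) = r"
    using rs by (simp add: card_Diff_subset)
  moreover have "opp_free n (if r \<le> n then Mn_V n - \<sigma> ` {a..<a + int s}
      else Mn_V n - (Mn_V n - \<sigma> ` {a..<a + int s}))"
  proof (cases "r \<le> n")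
    case True
    then have "opp_free n (\<sigma> ` {a + int s..<a + 2 * int n})"
      using rs by (intro frame_opp_free_arc[OF \<sigma>, of _ "a + int s"]) auto
    then show ?thesis using True rs by (simp add: arc_complement[OF \<sigma>])
  next
    case False
    then have "opp_free n (\<sigma> ` {a..<a + int s})"
      using rs by (intro frame_opp_free_arc[OF \<sigma>, of _ a]) auto
    then show ?thesis
      using False \<open>\<sigma> ` {a..<a + int s} \<subseteq> Mn_V n\<close> by (simp add: double_diff)
  qed
  ultimately show ?thesis by (simp add: H_fam_Mn_iff)
qed

text \<open>A vertex common to \<open>k\<close> members occupies a position that none of their
  complementary arcs covers.\<close>

lemma no_cover_starts:
  assumes "k_wise_intersecting k F" "0 < k" and \<sigma>: "frame n \<sigma>"
  shows "no_cover k (2 * int n) (int s) (starts n s F \<sigma>)"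
  unfolding no_cover_def
proof (intro allI impI)
  fix f :: "nat \<Rightarrow> int" and c
  assume f: "\<forall>i<k. f i \<in> starts n s F \<sigma>"
  then have "(\<Inter>i<k. Mn_V n - \<sigma> ` {f i..<f i + int s}) \<noteq> {}"
    using assms(1)[unfolded k_wise_intersecting_def, rule_format, of "\<lambda>i. Mn_V n - \<sigma> ` {f i..<f i + int s}"]
    unfolding starts_def by blast
  then obtain w where w: "\<forall>i<k. w \<in> Mn_V n - \<sigma> ` {f i..<f i + int s}" by blast
  then have "w \<in> \<sigma> ` {c..<c + 2 * int n}" using \<open>0 < k\<close> frame_image[OF \<sigma>] by blast
  then obtain y where "y \<in> {c..<c + 2 * int n}" "w = \<sigma> y" by blast
  then show "\<exists>y\<in>{c..<c + 2 * int n}. \<forall>i<k. y \<notin> {f i..<f i + int s}" using w by blast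
qed

lemma card_starts_star:
  assumes \<sigma>: "frame n \<sigma>" and rs: "r + s = 2 * n" and x: "x \<in> Mn_V n" and n: "1 \<le> n"
  shows "card (starts n s (H_star r (Mn_V n) (Mn_E n) x) \<sigma> \<inter> {0..<2 * int n}) = r"
proof -
  let ?S = "starts n s (H_star r (Mn_V n) (Mn_E n) x) \<sigma>"
  obtain y where y: "x = \<sigma> y" using x frame_image[OF \<sigma>, of 0] by blast
  \<comment> \<open>In the window \<open>c, ..., y\<close> of starts \<open>a\<close>, position
    \<open>y\<close> always lies in \<open>{a..<a + 2 * int n}\<close>. The arc misses
    \<open>y\<close> just for the first \<open>2 * n - s = r\<close> of them.\<close>
  define c where "c = y - 2 * int n + 1"
  have mem: "a \<in> ?S \<longleftrightarrow> a + int s \<le> y" if "a \<in> {c..<c + 2 * int n}" for a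
  proof -
    have "y \<in> {a..<a + 2 * int n}" using that by (auto simp: c_def)
    then have "\<sigma> y \<in> \<sigma> ` {a..<a + int s} \<longleftrightarrow> y \<in> {a..<a + int s}"
      using rs by (intro frame_mem_image[OF \<sigma>]) auto
    then show ?thesis
      using that x arc_complement_in_H[OF \<sigma> rs, of a] y
      by (auto simp: starts_def H_star_def c_def)
  qed
  have "?S \<inter> {c..<c + 2 * int n} = {c..y - int s}"
    using mem rs by (auto simp: c_def)
  moreover have "card {c..y - int s} = r" using rs by (simp add: c_def)
  ultimately show ?thesis
    using card_window[OF periodic_starts[OF \<sigma>], of s "H_star r (Mn_V n) (Mn_E n) x" c] n by simp
qed

text \<open>A member is determined by its \<open>opp_free\<close> core, the set itself or its
  complement. Two cores of equal size are initial arcs of two frames, and the automorphism between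
  these frames carries one core to the other.\<close>

lemma automorphism_image_H:
  assumes n: "1 \<le> n" and A: "A \<in> H_fam r (Mn_V n) (Mn_E n)" and B: "B \<in> H_fam r (Mn_V n) (Mn_E n)"
  obtains g where "g \<in> automorphisms n" "g ` A = B"
proof -
  define core where "core C = (if r \<le> n then C else Mn_V n - C)" for C
  have cA: "core A \<subseteq> Mn_V n" "opp_free n (core A)" and cB: "core B \<subseteq> Mn_V n" "opp_free n (core B)"
    using A B by (auto simp: H_fam_Mn_iff core_def)
  have sub: "A \<subseteq> Mn_V n" "B \<subseteq> Mn_V n" using A B by (auto simp: H_fam_Mn_iff)
  have "card (core A) = card (core B)"
    using A B sub by (simp add: core_def H_fam_Mn_iff card_Diff_subset finite_subset[OF _ finite_Mn_V])
  then obtain \<rho> \<sigma> where \<rho>: "frame n \<rho>" "core A = \<rho> ` {0..<int (card (core A))}"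
    and \<sigma>: "frame n \<sigma>" "core B = \<sigma> ` {0..<int (card (core A))}"
    using frame_through_opp_free[OF n cA] frame_through_opp_free[OF n cB] by metis
  obtain g where g: "g \<in> automorphisms n" "\<And>i. g (\<rho> i) = \<sigma> i"
    using automorphism_of_frame[OF n \<rho>(1) \<sigma>(1)] by blast
  have gp: "g permutes Mn_V n" using g by (simp add: automorphisms_def)
  have core: "g ` core A = core B"
    by (subst \<rho>(2), subst \<sigma>(2)) (simp add: image_image g(2))
  have "g ` A = B"
  proof (cases "r \<le> n")
    case True
    then show ?thesis using core by (simp add: core_def)
  next
    case False
    have "A = Mn_V n - core A" "B = Mn_V n - core B" using False sub by (auto simp: core_def)
    then show ?thesis
      using core image_set_diff[OF permutes_inj[OF gp], of "Mn_V n" "core A"] permutes_image[OF gp] by simp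
  qed
  then show ?thesis using that g by blast
qed

section \<open>Equidistribution and double counting\<close>

definition transporters :: "nat \<Rightarrow> nat set \<Rightarrow> nat set \<Rightarrow> (nat \<Rightarrow> nat) set" where
  "transporters n B A = {g \<in> automorphisms n. g ` B = A}"

lemma finite_transporters: "finite (transporters n B A)"
  by (simp add: transporters_def finite_automorphisms)

lemma card_transporters_le_left:
  assumes "h \<in> automorphisms n"
  shows "card (transporters n B A) \<le> card (transporters n B (h ` A))"
proof (rule card_inj_on_le[OF _ _ finite_transporters])
  have "inj h" using assms permutes_inj by (auto simp: automorphisms_def)
  then show "inj_on ((\<circ>) h) (transporters n B A)"
    by (intro inj_onI) (auto simp: fun_eq_iff inj_eq)
  show "(\<circ>) h ` transporters n B A \<subseteq> transporters n B (h ` A)"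
    using assms by (auto simp: transporters_def automorphisms_comp image_comp[symmetric])
qed

lemma card_transporters_le_right:
  assumes "h \<in> automorphisms n"
  shows "card (transporters n B A) \<le> card (transporters n (h ` B) A)"
proof (rule card_inj_on_le[OF _ _ finite_transporters])
  have hp: "h permutes Mn_V n" using assms by (auto simp: automorphisms_def)
  show "inj_on (\<lambda>g. g \<circ> inv h) (transporters n B A)"
  proof (rule inj_onI)
    fix g g' assume "g \<circ> inv h = g' \<circ> inv h"
    then have "g (inv h (h v)) = g' (inv h (h v))" for v by (metis comp_apply)
    then show "g = g'" using permutes_inverses[OF hp] by auto
  qed
  show "(\<lambda>g. g \<circ> inv h) ` transporters n B A \<subseteq> transporters n (h ` B) A"
    using automorphisms_comp[OF _ automorphisms_inv[OF assms]] permutes_inverses[OF hp]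
    by (auto simp: transporters_def image_image)
qed

text \<open>Composing with automorphisms on either side injects one transporter set into another,
  and transitivity on \<open>H_fam\<close> gives the inequality in both directions.\<close>

lemma card_transporters_eq:
  assumes n: "1 \<le> n" and "A \<in> H_fam r (Mn_V n) (Mn_E n)" "B \<in> H_fam r (Mn_V n) (Mn_E n)"
    "A' \<in> H_fam r (Mn_V n) (Mn_E n)" "B' \<in> H_fam r (Mn_V n) (Mn_E n)"
  shows "card (transporters n B A) = card (transporters n B' A')"
proof -
  have le: "card (transporters n Y X) \<le> card (transporters n Y' X')"
    if X: "X \<in> H_fam r (Mn_V n) (Mn_E n)" and X': "X' \<in> H_fam r (Mn_V n) (Mn_E n)"
      and Y: "Y \<in> H_fam r (Mn_V n) (Mn_E n)" and Y': "Y' \<in> H_fam r (Mn_V n) (Mn_E n)" for X X' Y Y'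
  proof -
    obtain g h where "g \<in> automorphisms n" "g ` X = X'" "h \<in> automorphisms n" "h ` Y = Y'"
      using automorphism_image_H[OF n X X'] automorphism_image_H[OF n Y Y'] by metis
    then show ?thesis
      using card_transporters_le_left[of g n Y X] card_transporters_le_right[of h n Y X'] by simp
  qed
  show ?thesis using le[of A A' B B'] le[of A' A B' B] assms by simp
qed

text \<open>Double counting of the pairs \<open>(g, a)\<close> for which \<open>g\<close> maps the
  complement of the arc at \<open>a\<close> into \<open>F\<close>: each of the \<open>2 * n\<close>
  arcs reaches each member equally often.\<close>

lemma sum_card_starts:
  assumes n: "1 \<le> n" and rs: "r + s = 2 * n" and \<rho>: "frame n \<rho>"
    and F: "F \<subseteq> H_fam r (Mn_V n) (Mn_E n)" and A0: "A0 \<in> H_fam r (Mn_V n) (Mn_E n)"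
  shows "(\<Sum>g\<in>automorphisms n. card (starts n s F (g \<circ> \<rho>) \<inter> {0..<2 * int n})) =
    2 * n * card F * card (transporters n A0 A0)"
proof -
  define C where "C a = Mn_V n - \<rho> ` {a..<a + int s}" for a
  have "H_fam r (Mn_V n) (Mn_E n) \<subseteq> Pow (Mn_V n)" by (auto simp: H_fam_Mn_iff)
  then have finF: "finite F" using F finite_subset[of F "Pow (Mn_V n)"] by auto
  have gC: "Mn_V n - (g \<circ> \<rho>) ` {a..<a + int s} = g ` C a" if "g \<in> automorphisms n" for g a
  proof -
    have gp: "g permutes Mn_V n" using that by (simp add: automorphisms_def)
    show ?thesis
      using image_set_diff[OF permutes_inj[OF gp], of "Mn_V n"] permutes_image[OF gp]
      by (simp add: C_def image_comp)
  qed
  have "card (starts n s F (g \<circ> \<rho>) \<inter> {0..<2 * int n}) =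
      (\<Sum>a\<in>{0..<2 * int n}. \<Sum>A\<in>F. if g ` C a = A then 1 else 0)" if g: "g \<in> automorphisms n" for g
  proof -
    have "starts n s F (g \<circ> \<rho>) \<inter> {0..<2 * int n} = {a \<in> {0..<2 * int n}. g ` C a \<in> F}"
      unfolding starts_def gC[OF g] by blast
    then show ?thesis using finF by (simp add: sum.If_cases Int_def)
  qed
  then have "(\<Sum>g\<in>automorphisms n. card (starts n s F (g \<circ> \<rho>) \<inter> {0..<2 * int n})) =
      (\<Sum>g\<in>automorphisms n. \<Sum>a\<in>{0..<2 * int n}. \<Sum>A\<in>F. if g ` C a = A then 1 else 0)"
    by simp
  also have "\<dots> = (\<Sum>a\<in>{0..<2 * int n}. \<Sum>g\<in>automorphisms n. \<Sum>A\<in>F. if g ` C a = A then 1 else 0)"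
    by (rule sum.swap)
  also have "\<dots> = (\<Sum>a\<in>{0..<2 * int n}. \<Sum>A\<in>F. \<Sum>g\<in>automorphisms n. if g ` C a = A then 1 else 0)"
    by (intro sum.cong refl sum.swap)
  also have "\<dots> = (\<Sum>a\<in>{0..<2 * int n}. \<Sum>A\<in>F. card (transporters n (C a) A))"
    by (simp add: transporters_def sum.If_cases finite_automorphisms Int_def)
  also have "\<dots> = (\<Sum>a\<in>{0..<2 * int n}. \<Sum>A\<in>F. card (transporters n A0 A0))"
    using F arc_complement_in_H[OF \<rho> rs] A0
    by (intro sum.cong refl card_transporters_eq[OF n, of _ r]) (auto simp: C_def)
  finally show ?thesis by (simp add: nat_mult_distrib)
qed

subsection \<open>Families attaining the bound\<close>

text \<open>The starts in \<open>{- int s<..0}\<close> are those whose arcs pass through position 0.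
  So every member whose complement is an arc of this frame contains
  \<open>\<sigma> 0\<close>.\<close>

definition centered :: "nat \<Rightarrow> nat \<Rightarrow> nat set set \<Rightarrow> (int \<Rightarrow> nat) \<Rightarrow> bool" where
  "centered n s F \<sigma> \<longleftrightarrow> frame n \<sigma> \<and> (\<forall>a\<in>{- int s<..0}. a \<notin> starts n s F \<sigma>)"

text \<open>Working modulo \<open>n\<close> exchanges \<open>i\<close> and \<open>i + 1\<close>
  together with their antipodes, so the antipodal rule survives. For \<open>1 \<le> i\<close> and
  \<open>i + 1 < n\<close>, position 0 and its antipode stay fixed.\<close>

definition swap_positions :: "nat \<Rightarrow> int \<Rightarrow> int \<Rightarrow> int" where
  "swap_positions n i x =
     (if x mod int n = i then x + 1 else if x mod int n = i + 1 then x - 1 else x)"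

lemma swap_positions_swap_positions:
  assumes "1 \<le> i" "i + 1 < int n"
  shows "swap_positions n i (swap_positions n i x) = x"
proof -
  have "(x + 1) mod int n = i + 1" if "x mod int n = i"
    using that assms mod_add_left_eq[of x "int n" 1] by simp
  moreover have "(x - 1) mod int n = i" if "x mod int n = i + 1"
    using that assms mod_diff_left_eq[of x "int n" 1] by simp
  ultimately show ?thesis by (simp add: swap_positions_def)
qed

lemma swap_positions_half: "swap_positions n i (x + int n) = swap_positions n i x + int n"
  by (simp add: swap_positions_def)

lemma frame_swap_positions:
  assumes \<sigma>: "frame n \<sigma>" and i: "1 \<le> i" "i + 1 < int n"
  shows "frame n (\<sigma> \<circ> swap_positions n i)"
proof -
  let ?\<tau> = "swap_positions n i"
  have \<tau>2: "?\<tau> (x + 2 * int n * q) = ?\<tau> x + 2 * int n * q" for x q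
  proof -
    have "(x + 2 * int n * q) mod int n = x mod int n"
      using mod_mult_self1[of x "2 * q" "int n"] by (simp add: mult_ac)
    then show ?thesis by (simp add: swap_positions_def)
  qed
  have "2 * int n dvd x - y" if "\<sigma> (?\<tau> x) = \<sigma> (?\<tau> y)" for x y
  proof -
    have "2 * int n dvd ?\<tau> x - ?\<tau> y" using that frame_eq_iff[OF \<sigma>] by blast
    then obtain q where "?\<tau> x - ?\<tau> y = 2 * int n * q" by (elim dvdE)
    then have "?\<tau> x = ?\<tau> (y + 2 * int n * q)" using \<tau>2[of y q] by linarith
    then have "x = y + 2 * int n * q" using swap_positions_swap_positions[OF i] by metis
    then show ?thesis by simp
  qed
  then show ?thesis
    using \<sigma> by (auto simp: frame_def swap_positions_half)
qed

text \<open>The equality case of the averaging: by \<open>full\<close>, every frame has the maximal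
  number of starts.\<close>

locale extremal_family =
  fixes k n r s :: nat and F :: "nat set set"
  assumes k: "2 \<le> k" and n: "1 \<le> n" and r: "1 \<le> r" and rs: "r + s = 2 * n"
    and strict: "2 * n < k * s"
    and kw: "k_wise_intersecting k F"
    and full: "\<And>\<sigma>. frame n \<sigma> \<Longrightarrow> card (starts n s F \<sigma> \<inter> {0..<2 * int n}) = r"
begin

lemma s_bounds: "1 \<le> s" "s < 2 * n"
  using strict r rs by (auto simp: Suc_le_eq intro: Nat.gr0I)

text \<open>One period consists of the \<open>s\<close> starts excluded by the centre and the
  positions \<open>1, ..., r\<close>. As there are \<open>r\<close> starts, all of the latter
  occur.\<close>

lemma centered_starts:
  assumes "centered n s F \<sigma>" "a \<in> {1..int r}"
  shows "a \<in> starts n s F \<sigma>"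
proof -
  let ?W = "{1 - int s..<1 - int s + 2 * int n}"
  have \<sigma>: "frame n \<sigma>" using assms by (simp add: centered_def)
  have "a' \<in> {1..int r}" if "a' \<in> starts n s F \<sigma> \<inter> ?W" for a'
    using that assms(1) rs by (force simp: centered_def)
  then have "starts n s F \<sigma> \<inter> ?W \<subseteq> {1..int r}" by blast
  moreover have "card (starts n s F \<sigma> \<inter> ?W) = r"
    using card_window[OF periodic_starts[OF \<sigma>], of s F "1 - int s"] full[OF \<sigma>] n by simp
  ultimately have "starts n s F \<sigma> \<inter> ?W = {1..int r}" by (intro card_subset_eq) auto
  then show ?thesis using assms(2) by blast
qed

text \<open>Were the complement of \<open>D\<close> in \<open>F\<close>, then \<open>D\<close> and \<open>k - 1\<close> arcs of length \<open>s\<close> avoiding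
  position \<open>0\<close> would cover all vertices.\<close>

lemma complement_notin:
  assumes c: "centered n s F \<sigma>" and D: "\<sigma> ` {a..b} \<subseteq> D" and "a \<le> 0" "0 \<le> b"
    and long: "2 * int n - (b - a + 1) \<le> int (k - 1) * int s"
  shows "Mn_V n - D \<notin> F"
proof
  assume DF: "Mn_V n - D \<in> F"
  have \<sigma>: "frame n \<sigma>" using c by (simp add: centered_def)
  \<comment> \<open>The arcs continue right after \<open>b\<close>. The cap at \<open>r\<close>
    keeps them among the starts known from \<open>centered_starts\<close>, and the arc at
    \<open>r\<close> still extends up to \<open>r + s = 2 * n\<close>, the next copy of position
    0.\<close>
  define start where "start i = min (b + 1 + int i * int s) (int r)" for i
  define G where "G i = (if i = 0 then Mn_V n - D
    else Mn_V n - \<sigma> ` {start (i - 1)..<start (i - 1) + int s})" for i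
  have "start i \<in> {1..int r}" for i
  proof -
    have "0 \<le> int i * int s" by simp
    then have "1 \<le> b + 1 + int i * int s" using \<open>0 \<le> b\<close> by linarith
    then show ?thesis using r by (simp add: start_def)
  qed
  then have "start i \<in> starts n s F \<sigma>" for i by (intro centered_starts[OF c])
  then have "\<forall>i<k. G i \<in> F" using DF by (auto simp: G_def starts_def)
  then have "(\<Inter>i<k. G i) \<noteq> {}" using kw by (simp add: k_wise_intersecting_def)
  then obtain w where w: "\<And>i. i < k \<Longrightarrow> w \<in> G i" by blast
  have "w \<in> Mn_V n - D" using w[of 0] k by (simp add: G_def)
  then have "w \<in> \<sigma> ` {a..<a + 2 * int n}" "w \<notin> D" using frame_image[OF \<sigma>] by auto
  then obtain y where y: "w = \<sigma> y" "y \<in> {a..<a + 2 * int n}" "y \<notin> {a..b}" using D by blast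
  then have by1: "b + 1 \<le> y" and by2: "y < b + 1 + int (k - 1) * int s" using long by auto
  have "0 < int s" using s_bounds by simp
  obtain i where i: "i < k - 1" "b + 1 + int i * int s \<le> y" "y < b + 1 + int i * int s + int s"
    using progression_cell[OF \<open>0 < int s\<close> by1 by2] by blast
  moreover have "y < int r + int s" using y(2) \<open>a \<le> 0\<close> rs by auto
  ultimately have "y \<in> {start i..<start i + int s}" by (auto simp: start_def)
  moreover have "i + 1 < k" using i(1) by simp
  then have "w \<in> G (i + 1)" by (rule w)
  ultimately show False using y(1) by (auto simp: G_def)
qed

text \<open>The swap costs an arc through the centre at most its end positions. What remains still
  passes through 0 and is long enough for \<open>complement_notin\<close>.\<close>

lemma centered_swap_positions:
  assumes c: "centered n s F \<sigma>" and i: "1 \<le> i" "i + 1 < int n"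
  shows "centered n s F (\<sigma> \<circ> swap_positions n i)"
proof -
  let ?\<tau> = "swap_positions n i"
  have "a \<notin> starts n s F (\<sigma> \<circ> ?\<tau>)" if a: "a \<in> {- int s<..0}" for a
  proof -
    define b where "b = a + int s - 1"
    \<comment> \<open>The swap exchanges \<open>a\<close> with \<open>a - 1\<close> if
      \<open>a\<close> is congruent to \<open>i + 1\<close>, and \<open>b\<close> with
      \<open>b + 1\<close> if \<open>b\<close> is congruent to \<open>i\<close>. Only then is that
      end trimmed.\<close>
    define a' where "a' = (if a mod int n = i + 1 then a + 1 else a)"
    define b' where "b' = (if b mod int n = i then b - 1 else b)"
    have "a \<noteq> 0" if "a mod int n = i + 1" using that i by auto
    then have "a' \<le> 0" using a by (cases "a mod int n = i + 1") (auto simp: a'_def)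
    have "b \<noteq> 0" if "b mod int n = i" using that i by auto
    moreover have "0 \<le> b" using a by (simp add: b_def)
    ultimately have "0 \<le> b'" by (cases "b mod int n = i") (auto simp: b'_def)
    have "\<sigma> x \<in> (\<sigma> \<circ> ?\<tau>) ` {a..b}" if x: "x \<in> {a'..b'}" for x
    proof (rule image_eqI)
      show "\<sigma> x = (\<sigma> \<circ> ?\<tau>) (?\<tau> x)" using swap_positions_swap_positions[OF i] by simp
      show "?\<tau> x \<in> {a..b}"
      proof -
        have xab: "a \<le> x" "x \<le> b" using x by (auto simp: a'_def b'_def split: if_splits)
        have "x < b" if "x mod int n = i"
        proof (cases "b mod int n = i")
          case True
          then show ?thesis using x by (simp add: b'_def)
        next
          case False
          then have "x \<noteq> b" using that by blast
          then show ?thesis using xab by simp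
        qed
        moreover have "a < x" if "x mod int n = i + 1"
        proof (cases "a mod int n = i + 1")
          case True
          then show ?thesis using x by (simp add: a'_def)
        next
          case False
          then have "x \<noteq> a" using that by blast
          then show ?thesis using xab by simp
        qed
        ultimately show ?thesis using xab
          by (cases "x mod int n = i"; cases "x mod int n = i + 1") (simp_all add: swap_positions_def)
      qed
    qed
    then have "\<sigma> ` {a'..b'} \<subseteq> (\<sigma> \<circ> ?\<tau>) ` {a..b}" by blast
    moreover have "2 * int n - (b' - a' + 1) \<le> int (k - 1) * int s"
    proof -
      have ks: "2 * int n < int (k - 1) * int s + int s"
      proof -
        have "int (k - 1) * int s + int s = int (k * s)" using k by (cases k) (auto simp: algebra_simps)
        then show ?thesis using strict by linarith
      qed
      show ?thesis
      proof (cases "a mod int n = i + 1 \<and> b mod int n = i")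
        case False
        then have "int s - 1 \<le> b' - a' + 1" by (auto simp: a'_def b'_def b_def)
        then show ?thesis using ks by linarith
      next
        case True
        \<comment> \<open>Losing both ends forces \<open>s = n\<close>. Strictness then gives
          \<open>k > 2\<close>, so \<open>k - 1\<close> arcs already have the total length of the
          cycle.\<close>
        then have "a mod int n = (b + 1) mod int n"
          using i mod_add_left_eq[of b "int n" 1] by simp
        then have "int n dvd a - (b + 1)" by (simp add: mod_eq_dvd_iff)
        then have "int n dvd int s" by (simp add: b_def)
        then have "n dvd s" by simp
        then obtain q where "s = n * q" by (elim dvdE)
        moreover have "q = 1"
        proof -
          have "n * 0 < n * q" "n * q < n * 2" using s_bounds \<open>s = n * q\<close> by auto
          then show ?thesis by (simp only: mult_less_cancel1) simp
        qed
        ultimately have "s = n" by simp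
        then have "2 < k" using strict n by simp
        then have "2 * int n \<le> int (k - 1) * int s"
          unfolding \<open>s = n\<close> by (intro mult_right_mono) auto
        moreover have "b' - a' + 1 = int n - 2"
          using True \<open>s = n\<close> by (simp add: a'_def b'_def b_def)
        moreover have "2 \<le> int n" using i by linarith
        ultimately show ?thesis by linarith
      qed
    qed
    ultimately have "Mn_V n - (\<sigma> \<circ> ?\<tau>) ` {a..b} \<notin> F"
      by (intro complement_notin[OF c _ \<open>a' \<le> 0\<close> \<open>0 \<le> b'\<close>])
    moreover have "{a..b} = {a..<a + int s}" by (auto simp: b_def)
    ultimately show ?thesis by (simp add: starts_def)
  qed
  then show ?thesis using c frame_swap_positions[OF _ i] by (simp add: centered_def)
qed

text \<open>Adjacent position swaps away from \<open>0\<close> sort the positions \<open>1, \<dots>, n - 1\<close> by weight: first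
  those with \<open>\<sigma> j \<in> B\<close>, last those with \<open>\<sigma> (j - n) \<in> B\<close>. Once sorted, \<open>B\<close> is an arc.\<close>

lemma opp_free_is_arc:
  assumes c: "centered n s F \<sigma>0" and B: "B \<subseteq> Mn_V n" "opp_free n B" "\<sigma>0 0 \<in> B"
  obtains \<sigma> a where "centered n s F \<sigma>" "B = \<sigma> ` {a..<a + int (card B)}" "a \<in> {- int (card B)<..0}"
proof -
  define w where "w \<sigma> j = (if \<sigma> (int j) \<in> B then 2 else if opp n (\<sigma> (int j)) \<in> B then 0 else 1 :: nat)"
    for \<sigma> :: "int \<Rightarrow> nat" and j
  \<comment> \<open>A larger weight to the right of a smaller one lets an adjacent swap decrease
    this sum. A minimiser among centred frames with the same vertex at 0 is therefore
    sorted.\<close>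
  define \<mu> where "\<mu> \<sigma> = (\<Sum>j\<in>{1..<n}. j * w \<sigma> j)" for \<sigma>
  let ?P = "\<lambda>\<sigma>. centered n s F \<sigma> \<and> \<sigma> 0 = \<sigma>0 0"
  obtain \<sigma> where P: "?P \<sigma>" and min: "\<And>\<sigma>'. ?P \<sigma>' \<Longrightarrow> \<mu> \<sigma> \<le> \<mu> \<sigma>'"
    using ex_has_least_nat[of ?P \<sigma>0 \<mu>] c by blast
  have \<sigma>: "frame n \<sigma>" using P by (simp add: centered_def)
  have adjacent: "w \<sigma> (j + 1) \<le> w \<sigma> j" if j: "1 \<le> j" "j + 1 < n" for j
  proof (rule ccontr)
    assume less: "\<not> ?thesis"
    let ?\<sigma>' = "\<sigma> \<circ> swap_positions n (int j)"
    have P': "?P ?\<sigma>'"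
      using P j centered_swap_positions[of \<sigma> "int j"] by (simp add: swap_positions_def)
    define R where "R = {1..<n} - {j, j + 1}"
    have split: "{1..<n} = insert j (insert (j + 1) R)" "j \<notin> R" "j + 1 \<notin> R" "finite R"
      using j by (auto simp: R_def)
    have "w ?\<sigma>' j = w \<sigma> (j + 1)" "w ?\<sigma>' (j + 1) = w \<sigma> j"
      using j by (simp_all add: w_def swap_positions_def add.commute)
    moreover have "w ?\<sigma>' i = w \<sigma> i" if "i \<in> R" for i
      using that by (auto simp: w_def swap_positions_def R_def)
    then have "(\<Sum>i\<in>R. i * w ?\<sigma>' i) = (\<Sum>i\<in>R. i * w \<sigma> i)" by simp
    moreover have "\<mu> \<rho> = j * w \<rho> j + (j + 1) * w \<rho> (j + 1) + (\<Sum>i\<in>R. i * w \<rho> i)" for \<rho>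
      unfolding \<mu>_def split(1) using split(2-4) by simp
    ultimately have "\<mu> ?\<sigma>' < \<mu> \<sigma>" using less by simp
    then show False using min[OF P'] by simp
  qed
  have mono: "w \<sigma> j' \<le> w \<sigma> j" if "1 \<le> j" "j \<le> j'" "j' < n" for j j'
    using that(2,3)
  proof (induction j' rule: dec_induct)
    case (step i)
    then show ?case using adjacent[of i] \<open>1 \<le> j\<close> by simp
  qed simp
  \<comment> \<open>One period of positions without \<open>- n\<close>, the antipode of 0, whose
    vertex is opposite to an element of \<open>B\<close>.\<close>
  define J where "J = {x \<in> {- int n<..<int n}. \<sigma> x \<in> B}"
  have "0 \<in> J" using n P B by (simp add: J_def)
  have finJ: "finite J" by (rule finite_subset[of _ "{- int n<..<int n}"]) (auto simp: J_def)
  have JB: "\<sigma> ` J = B"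
  proof
    show "B \<subseteq> \<sigma> ` J"
    proof
      fix v assume v: "v \<in> B"
      then have "v \<in> \<sigma> ` {- int n..<- int n + 2 * int n}" using B frame_image[OF \<sigma>] by blast
      then obtain x where x: "v = \<sigma> x" "- int n \<le> x" "x < int n" by auto
      have "x \<noteq> - int n"
      proof
        assume "x = - int n"
        then have "opp n v = \<sigma> 0" using x frame_half[OF \<sigma>, of x] by simp
        then show False using v B P by (auto simp: opp_free_def)
      qed
      then show "v \<in> \<sigma> ` J" using x v by (auto simp: J_def)
    qed
  qed (auto simp: J_def)
  \<comment> \<open>Weight 2 passes to all smaller positive positions, and weight 0 at
    \<open>x + n\<close> to all larger ones below \<open>n\<close>. So \<open>J\<close> has no holes
    on either side of 0.\<close>
  have pos: "y \<in> J" if "x \<in> J" "0 < y" "y \<le> x" for x y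
  proof -
    have "w \<sigma> (nat x) = 2" "x < int n" using that by (auto simp: w_def J_def)
    then have "2 \<le> w \<sigma> (nat y)" using mono[of "nat y" "nat x"] that by simp
    then show ?thesis using that \<open>x < int n\<close> by (auto simp: w_def J_def split: if_splits)
  qed
  have neg: "y \<in> J" if "x \<in> J" "y < 0" "x \<le> y" for x y
  proof -
    have x: "- int n < x" "\<sigma> x \<in> B" using that by (auto simp: J_def)
    have opp: "opp n (\<sigma> (z + int n)) = \<sigma> z" for z using \<sigma> by (simp add: frame_half)
    have "opp n (\<sigma> x) \<notin> B" using x B by (auto simp: opp_free_def)
    then have "w \<sigma> (nat (x + int n)) = 0"
      using x \<sigma> by (simp add: w_def frame_half)
    then have "w \<sigma> (nat (y + int n)) = 0"
      using mono[of "nat (x + int n)" "nat (y + int n)"] that x by simp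
    then have "\<sigma> y \<in> B"
      using that x opp[of y] by (simp add: w_def split: if_splits)
    then show ?thesis using that x by (simp add: J_def)
  qed
  define a b where "a = Min J" and "b = Max J"
  have ab: "a \<in> J" "b \<in> J" "a \<le> 0" "0 \<le> b"
  proof -
    have "J \<noteq> {}" using \<open>0 \<in> J\<close> by blast
    then show "a \<in> J" "b \<in> J" "a \<le> 0" "0 \<le> b"
      unfolding a_def b_def using finJ \<open>0 \<in> J\<close> by (simp_all add: Min_in Max_in)
  qed
  have J: "J = {a..b}"
  proof
    show "J \<subseteq> {a..b}" using finJ by (auto simp: a_def b_def)
    show "{a..b} \<subseteq> J"
    proof
      fix y assume "y \<in> {a..b}"
      then show "y \<in> J" using pos[OF ab(2), of y] neg[OF ab(1), of y] \<open>0 \<in> J\<close>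
        by (cases y "0 :: int" rule: linorder_cases) auto
    qed
  qed
  have "J \<subseteq> {- int n..<- int n + 2 * int n}" by (auto simp: J_def)
  then have "card B = card J" using card_image[OF frame_inj[OF \<sigma>]] JB by metis
  then have "int (card B) = b - a + 1" using ab by (simp add: J)
  then have "{a..<a + int (card B)} = J" "a \<in> {- int (card B)<..0}" using ab J by auto
  then show ?thesis using that P JB by metis
qed

text \<open>The star of the central vertex lies inside \<open>F\<close> for \<open>r \<le> n\<close>
  and contains \<open>F\<close> for \<open>r > n\<close>; equal cardinalities turn either inclusion
  into equality.\<close>

lemma eq_star:
  assumes F: "F \<subseteq> H_fam r (Mn_V n) (Mn_E n)"
    and card: "\<And>x. x \<in> Mn_V n \<Longrightarrow> card (H_star r (Mn_V n) (Mn_E n) x) = card F"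
  shows "\<exists>x\<in>Mn_V n. F = H_star r (Mn_V n) (Mn_E n) x"
proof -
  have "H_fam r (Mn_V n) (Mn_E n) \<subseteq> Pow (Mn_V n)" by (auto simp: H_fam_Mn_iff)
  then have finH: "finite (H_fam r (Mn_V n) (Mn_E n))" by (rule finite_subset) simp
  obtain \<rho> where \<rho>: "frame n \<rho>"
    using frame_through_opp_free[OF n, of "{}"] by (auto simp: opp_free_def)
  have "int (card (starts n s F \<rho> \<inter> {0..<2 * int n})) = 2 * int n - int s"
    using full[OF \<rho>] rs by simp
  moreover have "2 * int n < int k * int s" using strict by (metis of_nat_less_iff of_nat_mult of_nat_numeral)
  ultimately have "\<exists>p. \<forall>a\<in>{p - int s<..p}. a \<notin> starts n s F \<rho>"
    using s_bounds k by (intro starts_centered[OF no_cover_starts[OF kw _ \<rho>] periodic_starts[OF \<rho>]]) auto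
  then obtain p where p: "\<forall>a\<in>{p - int s<..p}. a \<notin> starts n s F \<rho>" by blast
  define \<sigma> where "\<sigma> i = \<rho> (i + p)" for i
  have "a \<notin> starts n s F \<sigma>" if "a \<in> {- int s<..0}" for a
  proof -
    have "\<sigma> ` {a..<a + int s} = \<rho> ` (\<lambda>x. x + p) ` {a..<a + int s}"
      unfolding image_image \<sigma>_def ..
    also have "(\<lambda>x. x + p) ` {a..<a + int s} = {a + p..<a + p + int s}"
      by (simp add: image_add_atLeastLessThan' algebra_simps)
    finally show ?thesis using p that by (simp add: starts_def)
  qed
  then have c: "centered n s F \<sigma>" using frame_shift[OF \<rho>, of p] by (simp add: centered_def \<sigma>_def[abs_def])
  let ?v = "\<sigma> 0"
  let ?H = "H_star r (Mn_V n) (Mn_E n) ?v"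
  have v: "?v \<in> Mn_V n" using c by (simp add: centered_def)
  have "F = ?H"
  proof (cases "r \<le> n")
    case True
    have "A \<in> F" if A: "A \<in> ?H" for A
    proof -
      have A': "A \<subseteq> Mn_V n" "opp_free n A" "?v \<in> A" "card A = r"
        using A True by (auto simp: H_star_def H_fam_Mn_iff)
      obtain \<sigma>' a where \<sigma>': "centered n s F \<sigma>'" "A = \<sigma>' ` {a..<a + int r}" "a \<in> {- int r<..0}"
        using opp_free_is_arc[OF c A'(1,2,3)] A'(4) by metis
      have fr: "frame n \<sigma>'" using \<sigma>' by (simp add: centered_def)
      \<comment> \<open>\<open>A\<close> is an arc of length \<open>r\<close>, so its complementary
        arc starts at \<open>a + int r\<close>, which lies in \<open>{1..int r}\<close>.\<close>
      have "{a + int r..<a + int r + int s} = {a + int r..<a + 2 * int n}" using rs by auto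
      then have "A = Mn_V n - \<sigma>' ` {a + int r..<a + int r + int s}"
        using arc_complement[OF fr, of r a] A'(1) \<sigma>'(2) rs by auto
      moreover have "a + int r \<in> starts n s F \<sigma>'"
        using \<sigma>'(3) by (intro centered_starts[OF \<sigma>'(1)]) auto
      ultimately show ?thesis by (simp add: starts_def)
    qed
    then show ?thesis
      using card[OF v] F finite_subset[OF F finH] by (intro card_subset_eq[symmetric]) auto
  next
    case False
    have "?v \<in> A" if A: "A \<in> F" for A
    proof (rule ccontr)
      assume nv: "?v \<notin> A"
      let ?B = "Mn_V n - A"
      have A': "A \<subseteq> Mn_V n" "card A = r" "opp_free n ?B"
        using subsetD[OF F A] False by (simp_all add: H_fam_Mn_iff)
      have "card ?B = s" using A' rs by (simp add: card_Diff_subset finite_subset[OF _ finite_Mn_V])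
      then obtain \<sigma>' a where \<sigma>': "centered n s F \<sigma>'" "?B = \<sigma>' ` {a..<a + int s}" "a \<in> {- int s<..0}"
        using opp_free_is_arc[OF c _ A'(3)] nv v by (metis DiffI Diff_subset)
      then have "Mn_V n - ?B \<notin> F" by (simp add: centered_def starts_def)
      then show False using A A'(1) by (simp add: double_diff)
    qed
    then have "F \<subseteq> ?H" using F by (auto simp: H_star_def)
    then show ?thesis
      using card[OF v] finH by (intro card_subset_eq) (auto simp: H_star_def)
  qed
  then show ?thesis using v by blast
qed

end

section \<open>Upper bound and equality by comparison with a star\<close>

theorem theorem1p4:
  fixes k n r :: nat and F :: "nat set set"
  assumes "k \<ge> 2" and "n \<ge> 1" and "r \<ge> 1"
    and "k * r \<le> (k - 1) * (2 * n)"
    and "F \<subseteq> H_fam r (Mn_V n) (Mn_E n)"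
    and "k_wise_intersecting k F"
  shows "card F \<le> bound n r \<and>
         (k * r < (k - 1) * (2 * n) \<longrightarrow>
           (card F = bound n r \<longleftrightarrow> (\<exists>x\<in>Mn_V n. F = H_star r (Mn_V n) (Mn_E n) x)))"
proof -
  note k = assms(1) and n = assms(2) and r = assms(3) and F = assms(5) and kw = assms(6)
  let ?H = "H_fam r (Mn_V n) (Mn_E n)"
  let ?star = "H_star r (Mn_V n) (Mn_E n)"
  have k1: "(k - 1) * (2 * n) + 2 * n = k * (2 * n)" using k by (cases k) auto
  have "k * r < k * (2 * n)" using assms(4) k1 n by linarith
  then have r2: "r < 2 * n" by simp
  define s where "s = 2 * n - r"
  have rs: "r + s = 2 * n" using r2 by (simp add: s_def)
  have krs: "k * r + k * s = k * (2 * n)" by (simp flip: rs add: distrib_left)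
  have "2 * n \<le> k * s" using assms(4) k1 krs by linarith
  then have ks: "2 * int n \<le> int k * int s" by (metis of_nat_le_iff of_nat_mult of_nat_numeral)
  have s: "1 \<le> s" "s < 2 * n" using r r2 by (auto simp: s_def)
  have le: "card (starts n s F \<sigma> \<inter> {0..<2 * int n}) \<le> r" if "frame n \<sigma>" for \<sigma>
    using card_starts_le[OF no_cover_starts[OF kw _ that] periodic_starts[OF that], of s] k s ks rs
    by fastforce
  obtain \<rho> where \<rho>: "frame n \<rho>"
    using frame_through_opp_free[OF n, of "{}"] by (auto simp: opp_free_def)
  have fr: "frame n (g \<circ> \<rho>)" if "g \<in> automorphisms n" for g
    using frame_automorphism[OF \<rho> that] .
  define A0 where "A0 = Mn_V n - \<rho> ` {0..<0 + int s}"
  have A0: "A0 \<in> ?H" unfolding A0_def by (rule arc_complement_in_H[OF \<rho> rs])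
  define c where "c = 2 * n * card (transporters n A0 A0)"
  have "id \<in> transporters n A0 A0" by (simp add: transporters_def automorphisms_def permutes_id)
  then have "c > 0" using n finite_transporters[of n A0 A0] by (auto simp: c_def card_gt_0_iff)
  have sumF: "(\<Sum>g\<in>automorphisms n. card (starts n s F (g \<circ> \<rho>) \<inter> {0..<2 * int n})) = card F * c"
    using sum_card_starts[OF n rs \<rho> F A0] by (simp add: c_def)
  have star_sub: "?star 1 \<subseteq> ?H" by (auto simp: H_star_def)
  have one: "1 \<in> Mn_V n" using n by (simp add: Mn_V_def)
  \<comment> \<open>A star has exactly \<open>r\<close> starts in every frame, so its total
    calibrates the average: the sum of the constant \<open>r\<close> is
    \<open>bound n r * c\<close>.\<close>
  have "(\<Sum>g\<in>automorphisms n. card (starts n s (?star 1) (g \<circ> \<rho>) \<inter> {0..<2 * int n})) = bound n r * c"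
    using sum_card_starts[OF n rs \<rho> star_sub A0] card_H_star[OF n r r2 one] by (simp add: c_def)
  then have sumr: "(\<Sum>g\<in>automorphisms n. r) = bound n r * c"
    using card_starts_star[OF fr rs one n] by simp
  have "card F * c \<le> bound n r * c"
    unfolding sumF[symmetric] sumr[symmetric] by (intro sum_mono le fr)
  then have "card F \<le> bound n r" using \<open>c > 0\<close> by simp
  moreover have "\<exists>x\<in>Mn_V n. F = ?star x" if strict: "k * r < (k - 1) * (2 * n)" and eq: "card F = bound n r"
  proof -
    \<comment> \<open>The two sums agree and each term is at most \<open>r\<close>, so every term
      equals \<open>r\<close>. This reaches all frames, each being of the form
      \<open>g \<circ> \<rho>\<close>.\<close>
    have all: "card (starts n s F (g \<circ> \<rho>) \<inter> {0..<2 * int n}) = r" if "g \<in> automorphisms n" for g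
      using sum_mono_inv[of "\<lambda>g. card (starts n s F (g \<circ> \<rho>) \<inter> {0..<2 * int n})" "automorphisms n" "\<lambda>g. r"]
        sumF sumr eq le[OF fr] that finite_automorphisms by simp
    interpret extremal_family k n r s F
    proof
      show "2 * n < k * s" using strict k1 krs by linarith
      fix \<sigma> assume "frame n \<sigma>"
      then obtain g where "g \<in> automorphisms n" "\<And>i. g (\<rho> i) = \<sigma> i"
        using automorphism_of_frame[OF n \<rho>] by blast
      moreover then have "\<sigma> = g \<circ> \<rho>" by auto
      ultimately show "card (starts n s F \<sigma> \<inter> {0..<2 * int n}) = r" using all by simp
    qed (use k n r rs kw in auto)
    show ?thesis using eq card_H_star[OF n r r2] by (intro eq_star[OF F]) simp
  qed
  ultimately show ?thesis using card_H_star[OF n r r2] by blast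
qed

end
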